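(* Let $d\ge1$, $0<m<1$, $R>0$. Assume $\rho_0\in L^\infty(B_R)$, $\rho_0\ge 0$; $V\in W^{2,\infty}(B_R)$, $V\ge 0$, $\nabla V\cdot\nu=0$ on $\partial B_R$; $K\in W^{2,\infty}(B_R\times B_R)$, $K(x,y)=K(y,x)\ge 0$, $\nabla_xK(x,y)\cdot\nu(x)=0$ for $(x,y)\in\partial B_R\times B_R$; and $\rho_0,V,K$ radially symmetric. Let $\widehat\mu$ and $\widehat M$ be the long-time limits described in the context. Assume furthermore that $$\frac{\partial}{\partial v}\left(V(x)+\int_{B_R}K(x,y)\,d\widehat\mu(y)\right)\bigg|_{v=|B_1||x|^d}\ge 0 .$$ Then $\widehat M\in C^2((0,R_v))$.
   Context: $B_R\subset\mathbb R^d$: open ball of radius $R$ centred at $0$; $\nu$ outward normal; $R_v=|B_R|$; $\widetilde{B_v}$: ball centred at $0$ of volume $v$; radial functions are written in the volume variable $v=|B_1||x|^d$; $\kappa(v)=d|B_1|^{1/d}v^{(d-1)/d}$. "$K$ radially symmetric" means invariant under simultaneous rotations of $x$ and $y$. Let $\rho$ be the strong solution of $\frac{\partial\rho}{\partial t}=\Delta\rho^m+\nabla\cdot(\rho\nabla V)+\nabla\cdot(\rho\nabla\int_{B_R}K(\cdot,y)\rho(y)\,dy)$ in $(0,\infty)\times B_R$ with $\rho(0,\cdot)=\rho_0$ and no-flux condition on $\partial B_R$ (strong: nonnegative weak solution with, for every $T$, $\rho\in C([0,T];L^1(B_R))\cap L^\infty((0,T)\times B_R)$, $\rho^m\in L^2(0,T;H^2(B_R))$,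 $\partial_t\rho\in L^2((0,T)\times B_R)$). Let $t_n\to\infty$, $\rho^{[n]}(t,x)=\rho(t+t_n,x)$ and $M^{[n]}(t,v)=\int_{\widetilde{B_v}}\rho^{[n]}_t\,dx$ for $t\in[0,1]$, $v\in[0,R_v]$. Along a subsequence: $\rho^{[n]}\to\widehat\mu$ in $C([0,1];W^{-1,1}(B_R))$ (norm $\inf\{\|F\|_{L^1}:\mu=\operatorname{div}F\}$) and weak-$*$ in $L^\infty(0,1;\mathcal M(\overline{B_R}))$, with $\widehat\mu$ a time-independent radial nonnegative measure; $M^{[n]}\to\widehat M$ in $C_{loc}([0,1]\times(0,R_v])$ and pointwise in $[0,1]\times[0,R_v]$, where $\widehat M\in C((0,R_v])$, $\widehat M(0)=0$, $\widehat M$ is time-independent and non-decreasing, and $\frac{\partial\widehat M}{\partial v}$ is the push-forward of $\widehat\mu$ under $x\mapsto|B_1||x|^d$. Moreover $\widehat M$ is a (stationary) viscosity solution of $\kappa(v)^2\big(\frac{\partial^2M}{\partial v^2}+\frac1m(\frac{\partial M}{\partial v})^{2-m}\mathfrak E[\widehat\mu]\big)=0$ on $(0,R_v)$, $\mathfrak E[\widehat\mu](v)=\frac{\partial}{\partial v}(V+\int_{B_R}K(\cdot,y)\,d\widehat\mu(y))$. *)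

theory Defs
  imports "HOL-Analysis.Analysis"
begin

section \<open>Function spaces\<close>

(* C^k on an open set S. *)
primrec C_k_on :: "nat \<Rightarrow> 'a::euclidean_space set \<Rightarrow> ('a \<Rightarrow> real) \<Rightarrow> bool" where
  "C_k_on 0 S f \<longleftrightarrow> continuous_on S f"
| "C_k_on (Suc k) S f \<longleftrightarrow>
     (\<forall>x\<in>S. f differentiable (at x)) \<and>
     (\<forall>b\<in>Basis. C_k_on k S (\<lambda>x. frechet_derivative f (at x) b))"

(* The space of smooth functions with compact support in S, each extended by zero. *)
definition test_function :: "'a::euclidean_space set \<Rightarrow> ('a \<Rightarrow> real) \<Rightarrow> bool" where
  "test_function S \<phi> \<longleftrightarrow>
     (\<forall>k. C_k_on k UNIV \<phi>) \<and> (\<exists>C. compact C \<and> C \<subseteq> S \<and> (\<forall>x. x \<notin> C \<longrightarrow> \<phi> x = 0))"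

definition Lp_on :: "ereal \<Rightarrow> 'a::euclidean_space set \<Rightarrow> ('a \<Rightarrow> real) \<Rightarrow> bool" where
  "Lp_on p S f \<longleftrightarrow> f \<in> borel_measurable (lebesgue_on S) \<and>
     (if p = \<infinity> then \<exists>C. AE x in lebesgue_on S. \<bar>f x\<bar> \<le> C
      else integrable (lebesgue_on S) (\<lambda>x. \<bar>f x\<bar> powr real_of_ereal p))"

definition locally_integrable_on :: "'a::euclidean_space set \<Rightarrow> ('a \<Rightarrow> real) \<Rightarrow> bool" where
  "locally_integrable_on S f \<longleftrightarrow>
     (\<forall>C. compact C \<and> C \<subseteq> S \<longrightarrow> integrable (lebesgue_on C) f)"

(* g is the weak derivative of u in direction b on the open set S. *)
definition weak_deriv ::
    "'a::euclidean_space set \<Rightarrow> 'a \<Rightarrow> ('a \<Rightarrow> real) \<Rightarrow> ('a \<Rightarrow> real) \<Rightarrow> bool" where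
  "weak_deriv S b u g \<longleftrightarrow> locally_integrable_on S u \<and> locally_integrable_on S g \<and>
     (\<forall>\<phi>. test_function S \<phi> \<longrightarrow>
        (LINT x|lebesgue_on S. u x * frechet_derivative \<phi> (at x) b) =
        - (LINT x|lebesgue_on S. g x * \<phi> x))"

(* The Sobolev space W^{k,p}(S). *)
primrec sobolev :: "nat \<Rightarrow> ereal \<Rightarrow> 'a::euclidean_space set \<Rightarrow> ('a \<Rightarrow> real) \<Rightarrow> bool" where
  "sobolev 0 p S u \<longleftrightarrow> Lp_on p S u"
| "sobolev (Suc k) p S u \<longleftrightarrow>
     Lp_on p S u \<and> (\<forall>b\<in>Basis. \<exists>g. weak_deriv S b u g \<and> sobolev k p S g)"

(* The Bochner space L^2(0,T;H^k(S)), with L^2(0,T;L^2(S)) identified with L^2((0,T) x S). *)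
primrec L2_Hk :: "nat \<Rightarrow> real \<Rightarrow> 'a::euclidean_space set \<Rightarrow> (real \<Rightarrow> 'a \<Rightarrow> real) \<Rightarrow> bool" where
  "L2_Hk 0 T S u \<longleftrightarrow> Lp_on 2 ({0<..<T} \<times> S) (\<lambda>(t, x). u t x)"
| "L2_Hk (Suc k) T S u \<longleftrightarrow> Lp_on 2 ({0<..<T} \<times> S) (\<lambda>(t, x). u t x) \<and>
     (\<forall>b\<in>Basis. \<exists>g. (AE t in lebesgue_on {0<..<T}. weak_deriv S b (u t) (g t)) \<and> L2_Hk k T S g)"

(* The space C([0,T];L^1(S)). *)
definition C_L1 :: "real \<Rightarrow> 'a::euclidean_space set \<Rightarrow> (real \<Rightarrow> 'a \<Rightarrow> real) \<Rightarrow> bool" where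
  "C_L1 T S u \<longleftrightarrow> (\<forall>t\<in>{0..T}. Lp_on 1 S (u t) \<and>
     ((\<lambda>s. LINT x|lebesgue_on S. \<bar>u s x - u t x\<bar>) \<longlongrightarrow> 0) (at t within {0..T}))"

definition grad :: "(real^'n \<Rightarrow> real) \<Rightarrow> real^'n \<Rightarrow> real^'n" where
  "grad f x = (\<chi> i. frechet_derivative f (at x) (axis i 1))"

(* The norm of W^{-1,1}(S), inf {|F|_{L^1} : L = div F}, for a distribution L on S,
   given by its action on test functions; infinite if there is no such F. *)
definition Wm11_norm :: "(real^'n) set \<Rightarrow> ((real^'n \<Rightarrow> real) \<Rightarrow> real) \<Rightarrow> ennreal" where
  "Wm11_norm S L =
     (INF F \<in> {F :: real^'n \<Rightarrow> real^'n. integrable (lebesgue_on S) F \<and>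
                 (\<forall>\<phi>. test_function S \<phi> \<longrightarrow>
                    L \<phi> = - (LINT x|lebesgue_on S. F x \<bullet> grad \<phi> x))}.
        \<integral>\<^sup>+ x. ennreal (norm (F x)) \<partial>lebesgue_on S)"

(* The space L^1(0,1;C(S)) for compact S. Since C(S) is separable, a function with values in it
   is strongly measurable iff all its point evaluations are measurable. *)
definition L1_C :: "'a::euclidean_space set \<Rightarrow> (real \<Rightarrow> 'a \<Rightarrow> real) \<Rightarrow> bool" where
  "L1_C S \<psi> \<longleftrightarrow>
     (\<forall>t\<in>{0..1}. continuous_on S (\<psi> t)) \<and>
     (\<forall>x\<in>S. (\<lambda>t. \<psi> t x) \<in> borel_measurable (lebesgue_on {0..1})) \<and>
     (\<exists>h. integrable (lebesgue_on {0..1}) h \<and> (\<forall>t\<in>{0..1}. \<forall>x\<in>S. \<bar>\<psi> t x\<bar> \<le> h t))"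

section \<open>Radial symmetry and the volume variable\<close>

(* SO(d) for d >= 2. In dimension one SO(1) is trivial and the radial functions are the even ones,
   so the reflection is included there. *)
definition rotations :: "(real^'n^'n) set" where
  "rotations = {Q. rotation_matrix Q \<or> (CARD('n) = 1 \<and> orthogonal_matrix Q)}"

definition ball_vol :: "'n::finite itself \<Rightarrow> real \<Rightarrow> real" where
  "ball_vol _ r = measure lebesgue (ball (0 :: real^'n) r)"

(* The inverse of r |-> |B_1| r^d. *)
definition vradius :: "'n::finite itself \<Rightarrow> real \<Rightarrow> real" where
  "vradius N v = root CARD('n) (v / ball_vol N 1)"

definition vball :: "real \<Rightarrow> (real^'n) set" where
  "vball v = ball 0 (vradius TYPE('n) v)"

definition kappa :: "'n::finite itself \<Rightarrow> real \<Rightarrow> real" where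
  "kappa N v = real CARD('n) * ball_vol N 1 powr (1 / real CARD('n))
                 * v powr ((real CARD('n) - 1) / real CARD('n))"

(* A radial function written in the volume variable; for radial f the choice of the unit vector
   is immaterial. *)
definition radial_profile :: "(real^'n \<Rightarrow> real) \<Rightarrow> real \<Rightarrow> real" where
  "radial_profile f v = f (vradius TYPE('n) v *\<^sub>R (SOME e. norm e = 1))"

section \<open>The evolution problem\<close>

(* grad f . nu = 0 on the boundary of B_R, where grad f is understood through its continuous
   extension to the closed ball (it is Lipschitz for f in W^{2,infinity}); sgn z is the outward
   normal at z. *)
definition neumann :: "real \<Rightarrow> (real^'n \<Rightarrow> real) \<Rightarrow> bool" where
  "neumann R f \<longleftrightarrow>
     (\<forall>z\<in>sphere 0 R. ((\<lambda>x. grad f x \<bullet> sgn z) \<longlongrightarrow> 0) (at z within ball 0 R))"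

(* Weak solution of
     d/dt rho = Laplace(rho^m) + div(rho grad V) + div(rho grad (int K(.,y) rho(y) dy))
   in (0,infinity) x B_R with initial datum rho0. G is the spatial weak gradient of rho^m. The
   test functions need not vanish at t = 0 nor on the boundary of B_R, which encodes the initial
   datum and the no-flux condition. *)
definition weak_solution ::
    "real \<Rightarrow> real \<Rightarrow> (real^'n \<Rightarrow> real) \<Rightarrow> (real^'n \<Rightarrow> real^'n \<Rightarrow> real) \<Rightarrow>
     (real^'n \<Rightarrow> real) \<Rightarrow> (real \<Rightarrow> real^'n \<Rightarrow> real) \<Rightarrow> bool" where
  "weak_solution m R V K \<rho>0 \<rho> \<longleftrightarrow>
     (\<forall>T>0. Lp_on 1 ({0<..<T} \<times> ball 0 R) (\<lambda>(t, x). \<rho> t x)) \<and>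
     (\<exists>G :: real \<Rightarrow> real^'n \<Rightarrow> real^'n.
        (\<forall>T>0. integrable (lebesgue_on ({0<..<T} \<times> ball 0 R)) (\<lambda>(t, x). G t x)) \<and>
        (AE t in lebesgue_on {0<..}. \<forall>b\<in>Basis.
           weak_deriv (ball 0 R) b (\<lambda>x. \<rho> t x powr m) (\<lambda>x. G t x \<bullet> b)) \<and>
        (\<forall>\<phi> :: real \<times> (real^'n) \<Rightarrow> real. test_function UNIV \<phi> \<longrightarrow>
           (LINT (t, x)|lebesgue_on ({0<..} \<times> ball 0 R).
              \<rho> t x * frechet_derivative \<phi> (at (t, x)) (1, 0)
              - (G t x + \<rho> t x *\<^sub>R grad V x
                   + \<rho> t x *\<^sub>R grad (\<lambda>z. LINT y|lebesgue_on (ball 0 R). K z y * \<rho> t y) x)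
                \<bullet> grad (\<lambda>z. \<phi> (t, z)) x)
           = - (LINT x|lebesgue_on (ball 0 R). \<rho>0 x * \<phi> (0, x))))"

definition strong_solution ::
    "real \<Rightarrow> real \<Rightarrow> (real^'n \<Rightarrow> real) \<Rightarrow> (real^'n \<Rightarrow> real^'n \<Rightarrow> real) \<Rightarrow>
     (real^'n \<Rightarrow> real) \<Rightarrow> (real \<Rightarrow> real^'n \<Rightarrow> real) \<Rightarrow> bool" where
  "strong_solution m R V K \<rho>0 \<rho> \<longleftrightarrow>
     weak_solution m R V K \<rho>0 \<rho> \<and>
     (\<forall>t\<ge>0. AE x in lebesgue_on (ball 0 R). 0 \<le> \<rho> t x) \<and>
     (AE x in lebesgue_on (ball 0 R). \<rho> 0 x = \<rho>0 x) \<and>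
     (\<forall>T>0.
        C_L1 T (ball 0 R) \<rho> \<and>
        Lp_on \<infinity> ({0<..<T} \<times> ball 0 R) (\<lambda>(t, x). \<rho> t x) \<and>
        L2_Hk 2 T (ball 0 R) (\<lambda>t x. \<rho> t x powr m) \<and>
        (\<exists>g. weak_deriv ({0<..<T} \<times> ball 0 R) (1, 0) (\<lambda>(t, x). \<rho> t x) g \<and>
             Lp_on 2 ({0<..<T} \<times> ball 0 R) g))"

section \<open>Long-time limits\<close>

definition mass :: "(real \<Rightarrow> real^'n \<Rightarrow> real) \<Rightarrow> real \<Rightarrow> real \<Rightarrow> real" where
  "mass \<rho> t v = (LINT x|lebesgue_on (vball v). \<rho> t x)"

(* Nonnegative finite radial Borel measures on the closed ball of radius R. *)
definition radial_measure :: "real \<Rightarrow> (real^'n) measure \<Rightarrow> bool" where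
  "radial_measure R \<mu> \<longleftrightarrow> sets \<mu> = sets borel \<and> finite_measure \<mu> \<and>
     emeasure \<mu> (- cball 0 R) = 0 \<and>
     (\<forall>Q\<in>rotations. distr \<mu> borel (\<lambda>x. Q *v x) = \<mu>)"

(* dM/dv = \<nu> as measures on [0,Rv]: M is extended by 0 to the left and by M(Rv) to the right, so
   that a jump of M at v = 0 (where M(0) = 0) corresponds to an atom of \<nu> at 0. *)
definition derivative_measure :: "real \<Rightarrow> (real \<Rightarrow> real) \<Rightarrow> real measure \<Rightarrow> bool" where
  "derivative_measure Rv M \<nu> \<longleftrightarrow>
     (\<forall>\<phi>. test_function UNIV \<phi> \<longrightarrow>
        (LINT v|lebesgue. (if v < 0 then 0 else if v \<le> Rv then M v else M Rv) * deriv \<phi> v) =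
        - (LINT v|\<nu>. \<phi> v))"

definition long_time_limit ::
    "real \<Rightarrow> (real \<Rightarrow> real^'n \<Rightarrow> real) \<Rightarrow> (nat \<Rightarrow> real) \<Rightarrow>
     (real^'n) measure \<Rightarrow> (real \<Rightarrow> real) \<Rightarrow> bool" where
  "long_time_limit R \<rho> tn \<mu> M \<longleftrightarrow>
     (let B = ball 0 R; Rv = ball_vol TYPE('n) R in
     radial_measure R \<mu> \<and>
     continuous_on {0<..Rv} M \<and> M 0 = 0 \<and> mono_on {0..Rv} M \<and>
     derivative_measure Rv M
       (distr \<mu> borel (\<lambda>x. ball_vol TYPE('n) 1 * norm x ^ CARD('n))) \<and>
     (\<exists>s :: nat \<Rightarrow> nat. strict_mono s \<and>
        \<comment> \<open>in C([0,1];W^{-1,1}(B))\<close>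
        ((\<lambda>n. SUP t\<in>{0..1}. Wm11_norm B
            (\<lambda>\<phi>. (LINT x|lebesgue_on B. \<phi> x * \<rho> (t + tn (s n)) x) - (LINT x:B|\<mu>. \<phi> x)))
          \<longlonglongrightarrow> 0) \<and>
        \<comment> \<open>weakly-star in L^infinity(0,1; measures on cball 0 R), the dual of L^1(0,1;C(cball 0 R))\<close>
        (\<forall>\<psi>. L1_C (cball 0 R) \<psi> \<longrightarrow>
           (\<lambda>n. LINT t|lebesgue_on {0..1}. LINT x|lebesgue_on B. \<psi> t x * \<rho> (t + tn (s n)) x)
           \<longlonglongrightarrow> (LINT t|lebesgue_on {0..1}. (LINT x:cball 0 R|\<mu>. \<psi> t x))) \<and>
        \<comment> \<open>in C_loc([0,1] x (0,Rv])\<close>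
        (\<forall>C. compact C \<and> C \<subseteq> {0..1} \<times> {0<..Rv} \<longrightarrow>
           uniform_limit C (\<lambda>n (t, v). mass \<rho> (t + tn (s n)) v) (\<lambda>(t, v). M v) sequentially) \<and>
        (\<forall>t\<in>{0..1}. \<forall>v\<in>{0..Rv}. (\<lambda>n. mass \<rho> (t + tn (s n)) v) \<longlonglongrightarrow> M v)))"

(* The functional E[mu] on (0,|B_R|). *)
definition drift ::
    "real \<Rightarrow> (real^'n \<Rightarrow> real) \<Rightarrow> (real^'n \<Rightarrow> real^'n \<Rightarrow> real) \<Rightarrow> (real^'n) measure \<Rightarrow>
     real \<Rightarrow> real" where
  "drift R V K \<mu> v = deriv (radial_profile (\<lambda>x. V x + (LINT y:ball 0 R|\<mu>. K x y))) v"

section \<open>Viscosity solutions\<close>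

(* Viscosity solutions of F(v, M', M'') = 0 on an open set I, for F nondecreasing in its last
   argument: touching from above gives F >= 0, touching from below gives F <= 0. *)
definition viscosity_solution ::
    "real set \<Rightarrow> (real \<Rightarrow> real \<Rightarrow> real \<Rightarrow> real) \<Rightarrow> (real \<Rightarrow> real) \<Rightarrow> bool" where
  "viscosity_solution I F M \<longleftrightarrow> continuous_on I M \<and>
     (\<forall>\<phi>. C_k_on 2 I \<phi> \<longrightarrow> (\<forall>a\<in>I.
        ((\<forall>\<^sub>F v in nhds a. M v - \<phi> v \<le> M a - \<phi> a) \<longrightarrow> F a (deriv \<phi> a) (deriv (deriv \<phi>) a) \<ge> 0) \<and>
        ((\<forall>\<^sub>F v in nhds a. M v - \<phi> v \<ge> M a - \<phi> a) \<longrightarrow> F a (deriv \<phi> a) (deriv (deriv \<phi>) a) \<le> 0)))"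

end

theory Submission
  imports Defs
begin

text \<open>
Where the coefficient of the equation is continuous, the equation itself produces the regularity:
the argument only tests \<open>M\<close> with parabolas. A continuous function that can be touched from above
only by convex parabolas is convex (\<open>convex_on_if_touching_parabolas_convex\<close>), so every one-sided
bound on \<open>M''\<close> in the viscosity sense is a genuine convexity statement. As the drift \<open>E\<close> is
nonnegative, the supersolution property makes \<open>M\<close> concave. A concave non-decreasing function has
slopes that are locally bounded and nonnegative, so the subsolution property bounds \<open>M''\<close> locally
from below, and \<open>M + c v\<^sup>2\<close> is locally convex. Being semiconvex and concave, \<open>M\<close> is
continuously differentiable (\<open>C1_if_semiconvex_semiconcave\<close>). Now \<open>f = (M')\<^bsup>2-m\<^esup> E / m\<close> is a
continuous function, and near a point \<open>a\<close> the equation squeezes \<open>M''\<close> between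
\<open>- f a - \<epsilon>\<close> and \<open>- f a + \<epsilon>\<close>, again as convexity statements; hence \<open>M'\<close> is
differentiable with derivative \<open>- f\<close>. This is \<open>degenerate_viscosity_solution_C2\<close>. The sign of
\<open>E\<close> is used for the concavity and, through it, for the bound on the slopes.

It remains to see that the drift is continuous, and this is where the \<open>W\<^bsup>2,\<infinity>\<^esup>\<close> regularity of
\<open>V\<close> and \<open>K\<close> enters. The drift only involves the derivative of the potential along one ray, so it
suffices to control second derivatives along lines. Testing the weak second derivative with
translates of a nonnegative bump function shows that a continuous \<open>W\<^bsup>2,\<infinity>\<^esup>\<close> function is both
semiconvex and semiconcave along every line, with a constant that does not depend on the line within
a fixed direction (\<open>sobolev_2_infinity_semiconvex\<close>). These convexity inequalities are pointwise and
uniform, so they survive integration of \<open>K\<close> in its second variable against an arbitrary finite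
measure, and the criterion \<open>C1_if_semiconvex_semiconcave\<close> applies once more
(\<open>potential_C1_along_ray\<close>).
\<close>

section \<open>Convexity and one-sided quadratic bounds\<close>

lemma convex_on_subgradient:
  fixes f :: "real \<Rightarrow> real"
  assumes "convex_on J f" "open J" "a \<in> J"
  obtains p where "\<And>s. s \<in> J \<Longrightarrow> f a + p * (s - a) \<le> f s"
  using convex_le_Inf_differential[OF assms(1), of a] assms by (metis interior_open)

text \<open>
The function \<open>C s\<^sup>2 - c s\<close> has a local minimum at \<open>0\<close>, where its derivative is \<open>- c\<close>.
\<close>
lemma linear_le_quadratic_imp_zero:
  fixes c C \<delta> :: real
  assumes "\<delta> > 0" "\<And>s. \<bar>s\<bar> < \<delta> \<Longrightarrow> c * s \<le> C * s\<^sup>2"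
  shows "c = 0"
proof -
  have d: "((\<lambda>s. C * s\<^sup>2 - c * s) has_real_derivative - c) (at 0)"
    by (auto intro!: derivative_eq_intros)
  have "- c = 0"
    by (rule DERIV_local_min[OF d assms(1)]) (use assms(2) in auto)
  then show ?thesis by simp
qed

lemma has_real_derivative_if_quadratic_error:
  fixes f :: "real \<Rightarrow> real"
  assumes \<delta>: "\<delta> > 0" and err: "\<And>s. \<bar>s - a\<bar> < \<delta> \<Longrightarrow> \<bar>f s - f a - p * (s - a)\<bar> \<le> C * (s - a)\<^sup>2"
  shows "(f has_real_derivative p) (at a)"
proof -
  have "((\<lambda>s. (f s - f a) / (s - a) - p) \<longlongrightarrow> 0) (at a)"
  proof (rule tendsto_0_le[where K = 1])
    show "((\<lambda>s. C * (s - a)) \<longlongrightarrow> 0) (at a)"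
      by (auto intro!: tendsto_eq_intros)
    show "\<forall>\<^sub>F s in at a. norm ((f s - f a) / (s - a) - p) \<le> norm (C * (s - a)) * 1"
      unfolding eventually_at
    proof (intro exI conjI ballI impI)
      fix s assume "s \<noteq> a \<and> dist s a < \<delta>"
      then have s: "\<bar>s - a\<bar> < \<delta>" "s \<noteq> a" by (auto simp: dist_real_def)
      have "\<bar>f s - f a - p * (s - a)\<bar> \<le> \<bar>C * (s - a)\<^sup>2\<bar>"
        using err[OF s(1)] by linarith
      then have "\<bar>f s - f a - p * (s - a)\<bar> / \<bar>s - a\<bar> \<le> \<bar>C * (s - a)\<^sup>2\<bar> / \<bar>s - a\<bar>"
        by (rule divide_right_mono) simp
      moreover have "(f s - f a) / (s - a) - p = (f s - f a - p * (s - a)) / (s - a)"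
        using s(2) by (simp add: field_simps)
      moreover have "\<bar>C * (s - a)\<^sup>2\<bar> = \<bar>C * (s - a)\<bar> * \<bar>s - a\<bar>"
        by (simp only: abs_mult power2_eq_square mult.assoc)
      then have "\<bar>C * (s - a)\<^sup>2\<bar> / \<bar>s - a\<bar> = \<bar>C * (s - a)\<bar>"
        using s(2) by simp
      ultimately show "norm ((f s - f a) / (s - a) - p) \<le> norm (C * (s - a)) * 1"
        by (simp only: real_norm_def abs_divide mult_1_right)
    qed (use \<delta> in auto)
  qed
  then show ?thesis
    unfolding has_field_derivative_iff by (simp add: LIM_zero_iff)
qed

text \<open>
With \<open>g = C s\<^sup>2 - f\<close>, the hypotheses say that \<open>f\<close> is convex and \<open>C s\<^sup>2 - f\<close> is convex. The
subgradients \<open>p\<close> of \<open>f\<close> and \<open>q\<close> of \<open>g\<close> at \<open>a\<close> add up to a subgradient of the smooth function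
\<open>C s\<^sup>2\<close>, so \<open>p + q = 2 C a\<close>; the supporting line of \<open>g\<close> then becomes the upper parabola for \<open>f\<close>.
\<close>
lemma semiconvex_semiconcave_sandwich:
  fixes f g :: "real \<Rightarrow> real"
  assumes J: "open J" and f: "convex_on J f" and g: "convex_on J g"
    and sum: "\<And>s. s \<in> J \<Longrightarrow> f s + g s = C * s\<^sup>2" and a: "a \<in> J"
  obtains p where "\<And>s. s \<in> J \<Longrightarrow> 0 \<le> f s - f a - p * (s - a) \<and> f s - f a - p * (s - a) \<le> C * (s - a)\<^sup>2"
proof -
  obtain p where p: "\<And>s. s \<in> J \<Longrightarrow> f a + p * (s - a) \<le> f s"
    using convex_on_subgradient[OF f J a] by blast
  obtain q where q: "\<And>s. s \<in> J \<Longrightarrow> g a + q * (s - a) \<le> g s"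
    using convex_on_subgradient[OF g J a] by blast
  obtain \<delta> where \<delta>: "\<delta> > 0" "ball a \<delta> \<subseteq> J" using J a openE by blast
  have "p + q - 2 * C * a = 0"
  proof (rule linear_le_quadratic_imp_zero[OF \<delta>(1)])
    fix s :: real assume "\<bar>s\<bar> < \<delta>"
    then have sJ: "a + s \<in> J" using \<delta>(2) by (auto simp: dist_real_def subset_iff)
    have "f a + g a + (p + q) * s \<le> C * (a + s)\<^sup>2"
      using p[OF sJ] q[OF sJ] sum[OF sJ] by (simp add: algebra_simps)
    then show "(p + q - 2 * C * a) * s \<le> C * s\<^sup>2"
      using sum[OF a] by (simp add: algebra_simps power2_eq_square)
  qed
  then have qq: "q = 2 * C * a - p" by simp
  show thesis
  proof (rule that)
    fix s assume s: "s \<in> J"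
    show "0 \<le> f s - f a - p * (s - a) \<and> f s - f a - p * (s - a) \<le> C * (s - a)\<^sup>2"
      using p[OF s] q[OF s] sum[OF s] sum[OF a] unfolding qq
      by (simp add: algebra_simps power2_eq_square)
  qed
qed

text \<open>
The sandwich at a point gives differentiability there; adding the sandwich at \<open>a\<close>, evaluated at
\<open>b\<close>, to the sandwich at \<open>b\<close>, evaluated at \<open>a\<close>, gives \<open>(f' b - f' a) (b - a) \<le> 2 C (b - a)\<^sup>2\<close>,
so the derivative is even Lipschitz.
\<close>
lemma C1_if_semiconvex_semiconcave:
  fixes f g :: "real \<Rightarrow> real"
  assumes J: "open J" and f: "convex_on J f" and g: "convex_on J g"
    and sum: "\<And>s. s \<in> J \<Longrightarrow> f s + g s = C * s\<^sup>2"
  obtains f' where "\<And>s. s \<in> J \<Longrightarrow> (f has_real_derivative f' s) (at s)" "continuous_on J f'"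
proof -
  have "\<forall>a\<in>J. \<exists>p. \<forall>s\<in>J. 0 \<le> f s - f a - p * (s - a) \<and> f s - f a - p * (s - a) \<le> C * (s - a)\<^sup>2"
    using semiconvex_semiconcave_sandwich[OF J f g sum] by (metis (no_types, lifting))
  then obtain p where p: "\<And>a s. a \<in> J \<Longrightarrow> s \<in> J \<Longrightarrow>
      0 \<le> f s - f a - p a * (s - a) \<and> f s - f a - p a * (s - a) \<le> C * (s - a)\<^sup>2"
    by metis
  have der: "(f has_real_derivative p a) (at a)" if a: "a \<in> J" for a
  proof -
    obtain \<delta> where \<delta>: "\<delta> > 0" "ball a \<delta> \<subseteq> J" using J a openE by blast
    show ?thesis
    proof (rule has_real_derivative_if_quadratic_error[OF \<delta>(1)])
      fix s assume "\<bar>s - a\<bar> < \<delta>"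
      then have "s \<in> J" using \<delta>(2) by (auto simp: dist_real_def abs_minus_commute)
      then show "\<bar>f s - f a - p a * (s - a)\<bar> \<le> C * (s - a)\<^sup>2" using p[OF a] by fastforce
    qed
  qed
  have lip: "\<bar>p b - p a\<bar> \<le> 2 * \<bar>C\<bar> * \<bar>b - a\<bar>" if ab: "a \<in> J" "b \<in> J" for a b
  proof (cases "a = b")
    case False
    have "\<bar>(p b - p a) * (b - a)\<bar> \<le> 2 * \<bar>C * (b - a)\<^sup>2\<bar>"
      using p[OF ab] p[OF ab(2,1)] power2_commute[of a b] by (auto simp: algebra_simps)
    then have "\<bar>p b - p a\<bar> * \<bar>b - a\<bar> \<le> (2 * \<bar>C\<bar> * \<bar>b - a\<bar>) * \<bar>b - a\<bar>"
      unfolding abs_mult power2_eq_square by (simp only: mult.assoc)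
    then show ?thesis using False by (simp add: mult_le_cancel_right)
  qed auto
  have "continuous_on J p"
    unfolding continuous_on_def
  proof
    fix a assume a: "a \<in> J"
    have "((\<lambda>b. p b - p a) \<longlongrightarrow> 0) (at a within J)"
    proof (rule tendsto_0_le[where K = 1])
      show "((\<lambda>b. 2 * \<bar>C\<bar> * \<bar>b - a\<bar>) \<longlongrightarrow> 0) (at a within J)"
        by (auto intro!: tendsto_eq_intros)
      show "\<forall>\<^sub>F b in at a within J. norm (p b - p a) \<le> norm (2 * \<bar>C\<bar> * \<bar>b - a\<bar>) * 1"
        using lip[OF a] by (auto simp: eventually_at_filter)
    qed
    then show "(p \<longlongrightarrow> p a) (at a within J)" by (simp add: LIM_zero_iff)
  qed
  then show thesis using that der by blast
qed

text \<open>
If \<open>u\<close> lies above one of its chords somewhere, it still exceeds the chord plus a small concave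
parabola vanishing at both ends. The maximum of the difference is attained in the interior, and there
a strictly concave parabola touches \<open>u\<close> from above.
\<close>
lemma convex_on_if_touching_parabolas_convex:
  fixes u :: "real \<Rightarrow> real"
  assumes J: "convex J" and cont: "continuous_on J u"
    and touch: "\<And>a p q. a \<in> interior J \<Longrightarrow>
      (\<forall>\<^sub>F v in nhds a. u v \<le> u a + p * (v - a) + q * (v - a)\<^sup>2) \<Longrightarrow> 0 \<le> q"
  shows "convex_on J u"
proof (rule convex_onI[OF _ J])
  fix t x y :: real assume t: "0 < t" "t < 1" and x: "x \<in> J" and y: "y \<in> J"
  have main: "u ((1 - t) * x + t * y) \<le> (1 - t) * u x + t * u y"
    if t: "0 < t" "t < 1" and x: "x \<in> J" and y: "y \<in> J" and xy: "x < y" for t x y :: real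
  proof (rule ccontr)
    define z where "z = (1 - t) * x + t * y"
    define k where "k = (u y - u x) / (y - x)"
    define l where "l v = u x + k * (v - x)" for v
    assume neg: "\<not> ?thesis"
    have zx: "z - x = t * (y - x)" and yz: "y - z = (1 - t) * (y - x)"
      by (auto simp: z_def algebra_simps)
    have pos: "(z - x) * (y - z) > 0"
      unfolding zx yz using t xy by (intro mult_pos_pos) auto
    have lz: "l z = (1 - t) * u x + t * u y"
    proof -
      have "k * (y - x) = u y - u x" using xy by (simp add: k_def)
      then have "k * (t * (y - x)) = t * (u y - u x)" by (metis mult.left_commute)
      then show ?thesis unfolding l_def zx by (simp add: algebra_simps)
    qed
    have gap: "u z - l z > 0" using neg unfolding lz z_def[symmetric] by simp
    \<comment> \<open>Half of the gap at \<open>z\<close> is left after subtracting the parabola, so the maximum is positive.\<close>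
    define \<epsilon> where "\<epsilon> = (u z - l z) / (2 * ((z - x) * (y - z)))"
    have \<epsilon>: "\<epsilon> > 0" using gap pos by (simp add: \<epsilon>_def)
    define h where "h v = u v - l v - \<epsilon> * ((v - x) * (y - v))" for v
    have sub: "{x..y} \<subseteq> J" using J x y by (metis atLeastatMost_empty_iff2 closed_segment_eq_real_ivl closed_segment_subset order_less_imp_le xy)
    have "continuous_on {x..y} h"
      unfolding h_def l_def by (intro continuous_intros continuous_on_subset[OF cont sub])
    then obtain a where a: "a \<in> {x..y}" "\<And>v. v \<in> {x..y} \<Longrightarrow> h v \<le> h a"
      using continuous_attains_sup[of "{x..y}" h] xy by auto
    have "h z = (u z - l z) / 2"
      using pos unfolding h_def \<epsilon>_def by (simp add: field_simps)
    then have "h z > 0" using gap by simp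
    moreover have "z \<in> {x..y}"
      using pos t xy zx yz by (smt (verit) atLeastAtMost_iff mult_nonneg_nonneg)
    ultimately have "h a > 0" using a(2) by fastforce
    moreover have "h x = 0" "h y = 0" using xy by (auto simp: h_def l_def k_def)
    ultimately have axy: "a \<in> {x<..<y}" using a(1) by (metis atLeastAtMost_iff greaterThanLessThan_iff less_le order.irrefl)
    have "\<forall>\<^sub>F v in nhds a. v \<in> {x<..<y}"
      using axy by (intro eventually_nhds_in_open) auto
    then have "\<forall>\<^sub>F v in nhds a. u v \<le> u a + (k + \<epsilon> * (x + y - 2 * a)) * (v - a) + (- \<epsilon>) * (v - a)\<^sup>2"
    proof (rule eventually_mono)
      fix v assume "v \<in> {x<..<y}"
      then have "h v \<le> h a" by (intro a(2)) auto
      then show "u v \<le> u a + (k + \<epsilon> * (x + y - 2 * a)) * (v - a) + (- \<epsilon>) * (v - a)\<^sup>2"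
        by (simp add: h_def l_def algebra_simps power2_eq_square)
    qed
    moreover have "a \<in> interior J"
      using axy sub by (meson greaterThanLessThan_subseteq_atLeastAtMost_iff interior_maximal open_greaterThanLessThan order.refl order.trans subsetD)
    ultimately have "0 \<le> - \<epsilon>" by (rule touch[rotated])
    then show False using \<epsilon> by simp
  qed
  show "u ((1 - t) *\<^sub>R x + t *\<^sub>R y) \<le> (1 - t) * u x + t * u y"
  proof (cases x y rule: linorder_cases)
    case less then show ?thesis using main[OF t x y] by simp
  next
    case equal then show ?thesis by (simp add: algebra_simps)
  next
    case greater then show ?thesis using main[of "1 - t" y x] t x y by (simp add: add.commute)
  qed
qed

section \<open>Viscosity solutions of the degenerate equation\<close>

text \<open>
On the real line the only basis vector is \<open>1\<close>, so the iterated partial derivatives in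
\<open>C_k_on\<close> are ordinary derivatives.
\<close>
lemma C_k_on_2_realI:
  fixes f f' f'' :: "real \<Rightarrow> real"
  assumes I: "open I" and 1: "\<And>x. x \<in> I \<Longrightarrow> (f has_real_derivative f' x) (at x)"
    and 2: "\<And>x. x \<in> I \<Longrightarrow> (f' has_real_derivative f'' x) (at x)" and 3: "continuous_on I f''"
  shows "C_k_on 2 I f"
proof -
  have eq: "frechet_derivative g (at x) 1 = D" if "(g has_real_derivative D) (at x)"
    for g :: "real \<Rightarrow> real" and D x
  proof -
    have "frechet_derivative g (at x) = (*) D"
      using frechet_derivative_at[of g "(*) D" x] that by (simp add: has_field_derivative_def)
    then show ?thesis by simp
  qed
  have e1: "frechet_derivative f (at x) 1 = f' x" if "x \<in> I" for x
    using eq[OF 1[OF that]] .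
  have d2: "((\<lambda>x. frechet_derivative f (at x) 1) has_real_derivative f'' x) (at x)" if x: "x \<in> I" for x
  proof (rule DERIV_cong_ev[THEN iffD2, OF refl _ refl 2[OF x]])
    show "\<forall>\<^sub>F x in nhds x. frechet_derivative f (at x) 1 = f' x"
      using eventually_nhds_in_open[OF I x] by eventually_elim (rule e1)
  qed
  show ?thesis
    unfolding numeral_2_eq_2 C_k_on.simps
    using 1 d2 3 eq[OF d2]
    by (auto simp: real_differentiable_def cong: continuous_on_cong)
qed

text \<open>
Dividing by \<open>s\<close> and letting \<open>s\<close> tend to \<open>0\<close> leaves the slope.
\<close>
lemma slope_nonneg_if_parabola_nonneg:
  fixes p k :: real
  assumes "\<forall>\<^sub>F s in at_right 0. 0 \<le> p * s + k * s\<^sup>2"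
  shows "0 \<le> p"
proof (rule tendsto_lowerbound)
  show "((\<lambda>s. p + k * s) \<longlongrightarrow> p) (at_right 0)"
    by (auto intro!: tendsto_eq_intros)
  have "\<forall>\<^sub>F s in at_right (0::real). 0 < s" by (simp add: eventually_at_right_less)
  with assms show "\<forall>\<^sub>F s in at_right 0. 0 \<le> p + k * s"
  proof eventually_elim
    case (elim s)
    have "0 \<le> s * (p + k * s)" using elim(1) by (simp add: algebra_simps power2_eq_square)
    then show ?case using elim(2) by (simp add: zero_le_mult_iff)
  qed
qed simp

text \<open>
To the right of \<open>a\<close> the touching parabola stays above \<open>M a\<close>, which forces a nonnegative slope; to
the left it stays above a line of slope \<open>L\<close>, which forces a slope of at most \<open>L\<close>. This bounds the
first-order term of the equation at a point of touching before \<open>M\<close> is known to be differentiable.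
\<close>
lemma touching_slope_bounds:
  fixes M :: "real \<Rightarrow> real"
  assumes touch: "\<forall>\<^sub>F v in nhds a. M v \<le> M a + p * (v - a) + k * (v - a)\<^sup>2"
    and inc: "\<forall>\<^sub>F v in nhds a. v > a \<longrightarrow> M a \<le> M v"
    and lip: "\<forall>\<^sub>F v in nhds a. v < a \<longrightarrow> M a - M v \<le> L * (a - v)"
  shows "0 \<le> p" "p \<le> L"
proof -
  have lim: "filterlim (\<lambda>s. a + c * s) (nhds a) (at_right 0)" for c :: real
    by (auto intro!: tendsto_eq_intros)
  have pos: "\<forall>\<^sub>F s in at_right (0::real). 0 < s" by (simp add: eventually_at_right_less)
  show "0 \<le> p"
  proof (rule slope_nonneg_if_parabola_nonneg)
    show "\<forall>\<^sub>F s in at_right 0. 0 \<le> p * s + k * s\<^sup>2"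
      using eventually_compose_filterlim[OF touch lim[of 1]] 
        eventually_compose_filterlim[OF inc lim[of 1]] pos
      by eventually_elim auto
  qed
  have "0 \<le> L - p"
  proof (rule slope_nonneg_if_parabola_nonneg)
    show "\<forall>\<^sub>F s in at_right 0. 0 \<le> (L - p) * s + k * s\<^sup>2"
      using eventually_compose_filterlim[OF touch lim[of "-1"]] 
        eventually_compose_filterlim[OF lip lim[of "-1"]] pos
      by eventually_elim (auto simp: algebra_simps)
  qed
  then show "p \<le> L" by simp
qed

lemma deriv_mono_if_convex:
  fixes f :: "real \<Rightarrow> real"
  assumes f: "convex_on J f" "open J" and J: "x \<in> J" "y \<in> J" "x \<le> y"
    and d: "(f has_real_derivative D) (at x)" "(f has_real_derivative E) (at y)"
  shows "D \<le> E"
proof (cases "x = y")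
  case True then show ?thesis using d DERIV_unique by blast
next
  case False
  have c: "connected J" using f(1) convex_connected convex_on_imp_convex by blast
  have "f y - f x \<ge> D * (y - x)" "f x - f y \<ge> E * (x - y)"
    using convex_on_imp_above_tangent[OF f(1) c _ _ has_field_derivative_at_within[OF d(1)]]
      convex_on_imp_above_tangent[OF f(1) c _ _ has_field_derivative_at_within[OF d(2)]] J f(2)
    by (auto simp: interior_open)
  then have "D * (y - x) \<le> E * (y - x)" by (simp add: algebra_simps)
  then show ?thesis using False J by (simp add: mult_le_cancel_right)
qed

text \<open>
The viscosity inequalities for \<open>M'' + H(M') E = 0\<close> are only required for parabolas. Nonnegativity
of \<open>H\<close> and \<open>E\<close> yields concavity, local boundedness of \<open>H(M') E\<close> yields \<open>C\<^sup>1\<close> regularity, and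
continuity of \<open>H(M') E\<close> then identifies the second derivative.
\<close>
theorem degenerate_viscosity_solution_C2:
  fixes M E H :: "real \<Rightarrow> real"
  assumes I: "open I" "convex I"
    and M: "continuous_on I M" "mono_on I M"
    and E: "continuous_on I E" "\<And>v. v \<in> I \<Longrightarrow> 0 \<le> E v"
    and H: "continuous_on {0..} H" "\<And>p. 0 \<le> H p"
    and sub: "\<And>a p q. a \<in> I \<Longrightarrow> \<forall>\<^sub>F v in nhds a. M v \<le> M a + p * (v - a) + q * (v - a)\<^sup>2
        \<Longrightarrow> 0 \<le> 2 * q + H p * E a"
    and super: "\<And>a p q. a \<in> I \<Longrightarrow> \<forall>\<^sub>F v in nhds a. M v \<ge> M a + p * (v - a) + q * (v - a)\<^sup>2
        \<Longrightarrow> 2 * q + H p * E a \<le> 0"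
  shows "C_k_on 2 I M"
proof -
  \<comment> \<open>Adding a multiple of \<open>v\<^sup>2\<close> to \<open>M\<close> shifts the curvature of the touching parabolas.\<close>
  have shift: "(\<forall>\<^sub>F v in nhds a. M v + c * v\<^sup>2 \<le> M a + c * a\<^sup>2 + p * (v - a) + q * (v - a)\<^sup>2) \<longleftrightarrow>
     (\<forall>\<^sub>F v in nhds a. M v \<le> M a + (p - 2 * c * a) * (v - a) + (q - c) * (v - a)\<^sup>2)" for a c p q
    by (rule eventually_cong[OF always_eventually]) (auto simp: algebra_simps power2_eq_square)
  have shift': "(\<forall>\<^sub>F v in nhds a. c * v\<^sup>2 - M v \<le> c * a\<^sup>2 - M a + p * (v - a) + q * (v - a)\<^sup>2) \<longleftrightarrow>
     (\<forall>\<^sub>F v in nhds a. M v \<ge> M a + (2 * c * a - p) * (v - a) + (c - q) * (v - a)\<^sup>2)" for a c p q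
    by (rule eventually_cong[OF always_eventually]) (auto simp: algebra_simps power2_eq_square)
  have concave: "convex_on I (\<lambda>v. - M v)"
  proof (rule convex_on_if_touching_parabolas_convex)
    fix a p q assume "a \<in> interior I" and
      t: "\<forall>\<^sub>F v in nhds a. - M v \<le> - M a + p * (v - a) + q * (v - a)\<^sup>2"
    then have a: "a \<in> I" using I by (simp add: interior_open)
    have "2 * (0 - q) + H (2 * 0 * a - p) * E a \<le> 0"
      using t shift'[of 0 a p q] by (intro super[OF a]) simp
    then show "0 \<le> q" using mult_nonneg_nonneg[OF H(2) E(2)[OF a], of "- p"] by simp
  qed (use I M in \<open>auto intro!: continuous_intros\<close>)
  have C1: "\<exists>p. \<alpha> < a \<and> a < \<beta> \<and> {\<alpha><..<\<beta>} \<subseteq> I \<and> (\<forall>v\<in>{\<alpha><..<\<beta>}. (M has_real_derivative p v) (at v)) \<and> continuous_on {\<alpha><..<\<beta>} p"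
    if \<alpha>: "\<alpha>' < \<alpha>" "\<alpha> < a" "a < \<beta>" and sub_I: "{\<alpha>'..\<beta>} \<subseteq> I" for \<alpha>' \<alpha> a \<beta>
  proof -
    \<comment> \<open>By concavity, \<open>L\<close> bounds the slopes of all chords of \<open>M\<close> between points of \<open>{\<alpha>..\<beta>}\<close>.\<close>
    define L where "L = (M \<beta> - M \<alpha>') / (\<alpha> - \<alpha>')"
    obtain h where h: "\<And>p. p \<in> {0..L} \<Longrightarrow> H p \<le> h"
      using continuous_on_compact_bound[of "{0..L}" H] continuous_on_subset[OF H(1)]
      by (metis abs_le_D1 atLeastAtMost_iff atLeast_iff compact_Icc real_norm_def subsetI)
    have sub_I': "{\<alpha>..\<beta>} \<subseteq> I" using sub_I \<alpha> by auto
    obtain e where e: "\<And>v. v \<in> {\<alpha>..\<beta>} \<Longrightarrow> E v \<le> e"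
      using continuous_on_compact_bound[of "{\<alpha>..\<beta>}" E] continuous_on_subset[OF E(1) sub_I']
      by (metis abs_le_D1 compact_Icc real_norm_def)
    \<comment> \<open>The subsolution property bounds \<open>M''\<close> below by \<open>- h e\<close>, and \<open>c v\<^sup>2\<close> has second derivative \<open>h e\<close>.\<close>
    define c where "c = h * e / 2"
    define J where "J = {\<alpha><..<\<beta>}"
    have J: "open J" "convex J" "J \<subseteq> I" using sub_I \<alpha> by (auto simp: J_def)
    have cv: "convex_on J (\<lambda>v. M v + c * v\<^sup>2)"
    proof (rule convex_on_if_touching_parabolas_convex)
      fix b p q assume "b \<in> interior J" and
        t: "\<forall>\<^sub>F v in nhds b. M v + c * v\<^sup>2 \<le> M b + c * b\<^sup>2 + p * (v - b) + q * (v - b)\<^sup>2"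
      then have b: "b \<in> J" using J by (simp add: interior_open)
      then have bI: "b \<in> I" and b1: "\<alpha> < b" "b < \<beta>" using J by (auto simp: J_def)
      define p' where "p' = p - 2 * c * b"
      have t': "\<forall>\<^sub>F v in nhds b. M v \<le> M b + p' * (v - b) + (q - c) * (v - b)\<^sup>2"
        using t unfolding shift p'_def .
      have near: "\<forall>\<^sub>F v in nhds b. v \<in> J" by (rule eventually_nhds_in_open[OF J(1) b])
      have inc: "\<forall>\<^sub>F v in nhds b. v > b \<longrightarrow> M b \<le> M v"
        using near by eventually_elim (use J(3) bI in \<open>auto intro!: mono_onD[OF M(2)]\<close>)
      have lip: "\<forall>\<^sub>F v in nhds b. v < b \<longrightarrow> M b - M v \<le> L * (b - v)"
        using near
      proof (eventually_elim, intro impI)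
        fix v assume v: "v \<in> J" "v < b"
        have "M b - M \<alpha>' \<le> M \<beta> - M \<alpha>'" "0 \<le> M \<beta> - M \<alpha>'"
          using sub_I b1 \<alpha> by (auto intro!: mono_onD[OF M(2)] simp: subset_iff)
        then have "(M b - M \<alpha>') / (b - \<alpha>') \<le> L"
          unfolding L_def using b1 \<alpha> by (intro frac_le) auto
        moreover have "(M b - M v) / (b - v) \<le> (M b - M \<alpha>') / (b - \<alpha>')"
        proof -
          have "(- M \<alpha>' - - M b) / (\<alpha>' - b) \<le> (- M v - - M b) / (v - b)"
            using v \<alpha> b1 J(3) bI sub_I
            by (intro convex_on_slope_le(2)[OF concave]) (auto simp: J_def)
          moreover have "(- M \<alpha>' - - M b) / (\<alpha>' - b) = - ((M b - M \<alpha>') / (b - \<alpha>'))"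
            using b1 \<alpha> by (simp add: divide_simps algebra_simps)
          moreover have "(- M v - - M b) / (v - b) = - ((M b - M v) / (b - v))"
            using v(2) by (simp add: divide_simps algebra_simps)
          ultimately show ?thesis by linarith
        qed
        ultimately have "(M b - M v) / (b - v) \<le> L" by simp
        then show "M b - M v \<le> L * (b - v)" using v(2) by (simp add: divide_le_eq)
      qed
      have p': "p' \<in> {0..L}" using touching_slope_bounds[OF t' inc lip] by simp
      have "H p' * E b \<le> h * e"
        using h[OF p'] e[of b] b1 E(2)[OF bI] H(2)[of p'] order_trans[OF H(2) h[OF p']]
        by (intro mult_mono) auto
      then show "0 \<le> q" using sub[OF bI t'] unfolding c_def by simp
    qed (use J in \<open>auto intro!: continuous_intros continuous_on_subset[OF M(1)]\<close>)
    have cc: "convex_on J (\<lambda>v. - M v)" using concave J convex_on_subset by blast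
    obtain f' where f': "\<And>s. s \<in> J \<Longrightarrow> ((\<lambda>v. M v + c * v\<^sup>2) has_real_derivative f' s) (at s)"
      "continuous_on J f'"
      using C1_if_semiconvex_semiconcave[OF J(1) cv cc, of c] by auto
    have "(M has_real_derivative f' v - 2 * c * v) (at v)" if "v \<in> J" for v
    proof -
      have "((\<lambda>v. (M v + c * v\<^sup>2) - c * v\<^sup>2) has_real_derivative f' v - 2 * c * v) (at v)"
        by (rule derivative_eq_intros f'(1)[OF that] refl | simp)+
      then show ?thesis by simp
    qed
    moreover have "continuous_on J (\<lambda>v. f' v - 2 * c * v)"
      by (intro continuous_intros f'(2))
    ultimately show ?thesis
      using J(3) \<alpha> unfolding J_def[symmetric] by (intro exI[of _ "\<lambda>v. f' v - 2 * c * v"]) simp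
  qed
  have nbhd: "\<exists>\<alpha>' \<alpha> \<beta>. \<alpha>' < \<alpha> \<and> \<alpha> < a \<and> a < \<beta> \<and> {\<alpha>'..\<beta>} \<subseteq> I" if a: "a \<in> I" for a
  proof -
    obtain \<delta> where \<delta>: "\<delta> > 0" "cball a \<delta> \<subseteq> I" using I(1) a open_contains_cball by blast
    then have "{a - \<delta>..a + \<delta>} \<subseteq> I" by (simp add: cball_eq_atLeastAtMost)
    then show ?thesis using \<delta>(1)
      by (intro exI[of _ "a - \<delta>"] exI[of _ "a - \<delta> / 2"] exI[of _ "a + \<delta>"]) auto
  qed
  define M' where "M' = deriv M"
  have M': "(M has_real_derivative M' a) (at a)" and M'_cont: "isCont M' a" if a: "a \<in> I" for a
  proof -
    obtain \<alpha>' \<alpha> \<beta> where \<alpha>: "\<alpha>' < \<alpha>" "\<alpha> < a" "a < \<beta>" "{\<alpha>'..\<beta>} \<subseteq> I" using nbhd[OF a] by blast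
    obtain p where p: "\<And>v. v \<in> {\<alpha><..<\<beta>} \<Longrightarrow> (M has_real_derivative p v) (at v)"
      "continuous_on {\<alpha><..<\<beta>} p" using C1[OF \<alpha>] by blast
    have eq: "M' v = p v" if "v \<in> {\<alpha><..<\<beta>}" for v
      unfolding M'_def using p(1)[OF that] by (rule DERIV_imp_deriv)
    have aJ: "a \<in> {\<alpha><..<\<beta>}" using \<alpha> by simp
    show "(M has_real_derivative M' a) (at a)" using p(1)[OF aJ] eq[OF aJ] by simp
    have "continuous_on {\<alpha><..<\<beta>} M'" using p(2) by (subst continuous_on_cong[OF refl eq])
    then show "isCont M' a" using aJ by (simp add: continuous_on_eq_continuous_at)
  qed
  have M'_nonneg: "0 \<le> M' a" if a: "a \<in> I" for a
  proof -
    have "mono_on I M" by (rule M(2))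
    then show ?thesis using M'[OF a] I(1) a
      by (metis interior_open mono_on_imp_deriv_nonneg)
  qed
  define f where "f v = H (M' v) * E v" for v
  have f_cont: "continuous_on I f"
    unfolding f_def
    using M'_nonneg M'_cont
    by (intro continuous_intros E(1) continuous_on_compose2[OF H(1)])
      (auto intro!: continuous_at_imp_continuous_on)
  \<comment> \<open>Now that \<open>M\<close> is differentiable, touching parabolas are tangent to it.\<close>
  have tan: "p = M' b" 
    if "b \<in> I" and "(\<forall>\<^sub>F v in nhds b. M v \<le> M b + p * (v - b) + q * (v - b)\<^sup>2) \<or>
        (\<forall>\<^sub>F v in nhds b. M v \<ge> M b + p * (v - b) + q * (v - b)\<^sup>2)" for b p q
  proof -
    have d: "((\<lambda>v. M v - (M b + p * (v - b) + q * (v - b)\<^sup>2)) has_real_derivative M' b - p) (at b)"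
      by (auto intro!: derivative_eq_intros M'[OF that(1)])
    from that(2) have "M' b - p = 0"
    proof
      assume "\<forall>\<^sub>F v in nhds b. M v \<le> M b + p * (v - b) + q * (v - b)\<^sup>2"
      then obtain \<delta> where "\<delta> > 0" "\<And>v. dist v b < \<delta> \<Longrightarrow> M v \<le> M b + p * (v - b) + q * (v - b)\<^sup>2"
        unfolding eventually_nhds_metric by blast
      then show ?thesis by (intro DERIV_local_max[OF d]) (auto simp: dist_real_def abs_minus_commute)
    next
      assume "\<forall>\<^sub>F v in nhds b. M v \<ge> M b + p * (v - b) + q * (v - b)\<^sup>2"
      then obtain \<delta> where "\<delta> > 0" "\<And>v. dist v b < \<delta> \<Longrightarrow> M v \<ge> M b + p * (v - b) + q * (v - b)\<^sup>2"
        unfolding eventually_nhds_metric by blast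
      then show ?thesis by (intro DERIV_local_min[OF d]) (auto simp: dist_real_def abs_minus_commute)
    qed
    then show ?thesis by simp
  qed
  have M'': "(M' has_real_derivative - f a) (at a)" if a: "a \<in> I" for a
  proof -
    have est: "\<forall>\<^sub>F v in at a. \<bar>(M' v - M' a) / (v - a) + f a\<bar> \<le> \<epsilon>" if \<epsilon>: "\<epsilon> > 0" for \<epsilon>
    proof -
      have "isCont f a" using f_cont a I(1) by (simp add: continuous_on_eq_continuous_at)
      then have "\<forall>\<^sub>F v in nhds a. dist (f v) (f a) < \<epsilon>"
        using \<epsilon> by (simp add: continuous_at_eps_delta eventually_nhds_metric)
      then have "\<forall>\<^sub>F v in nhds a. dist (f v) (f a) < \<epsilon> \<and> v \<in> I"
        using eventually_nhds_in_open[OF I(1) a] by eventually_elim auto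
      then obtain \<delta> where d: "\<delta> > 0" "\<And>v. dist v a < \<delta> \<Longrightarrow> dist (f v) (f a) < \<epsilon> \<and> v \<in> I"
        unfolding eventually_nhds_metric by blast
      then have \<delta>: "\<delta> > 0" "\<And>v. v \<in> ball a \<delta> \<Longrightarrow> \<bar>f v - f a\<bar> < \<epsilon>" "ball a \<delta> \<subseteq> I"
        by (auto simp: dist_commute dist_real_def)
      define J where "J = ball a \<delta>"
      have J: "open J" "convex J" "J \<subseteq> I" "a \<in> J" using \<delta> by (auto simp: J_def)
      let ?c = "(f a + \<epsilon>) / 2" and ?c' = "(\<epsilon> - f a) / 2"
      \<comment> \<open>On \<open>J\<close> the equation reads \<open>- f a - \<epsilon> < M'' < - f a + \<epsilon>\<close> in the viscosity sense.\<close>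
      have up: "convex_on J (\<lambda>v. M v + ?c * v\<^sup>2)"
      proof (rule convex_on_if_touching_parabolas_convex)
        fix b p q assume "b \<in> interior J" and
          t: "\<forall>\<^sub>F v in nhds b. M v + ?c * v\<^sup>2 \<le> M b + ?c * b\<^sup>2 + p * (v - b) + q * (v - b)\<^sup>2"
        then have b: "b \<in> J" using J by (simp add: interior_open)
        then have bI: "b \<in> I" using J by blast
        note t' = t[unfolded shift]
        have "0 \<le> 2 * (q - ?c) + f b"
          using sub[OF bI t'] tan[OF bI disjI1[OF t']] by (simp add: f_def)
        moreover have "\<bar>f b - f a\<bar> < \<epsilon>" using \<delta>(2) b unfolding J_def by blast
        ultimately show "0 \<le> q" unfolding abs_less_iff by (simp add: field_simps)
      qed (use J in \<open>auto intro!: continuous_intros continuous_on_subset[OF M(1)]\<close>)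
      have lo: "convex_on J (\<lambda>v. ?c' * v\<^sup>2 - M v)"
      proof (rule convex_on_if_touching_parabolas_convex)
        fix b p q assume "b \<in> interior J" and
          t: "\<forall>\<^sub>F v in nhds b. ?c' * v\<^sup>2 - M v \<le> ?c' * b\<^sup>2 - M b + p * (v - b) + q * (v - b)\<^sup>2"
        then have b: "b \<in> J" using J by (simp add: interior_open)
        then have bI: "b \<in> I" using J by blast
        note t' = t[unfolded shift']
        have "2 * (?c' - q) + f b \<le> 0"
          using super[OF bI t'] tan[OF bI disjI2[OF t']] by (simp add: f_def)
        moreover have "\<bar>f b - f a\<bar> < \<epsilon>" using \<delta>(2) b unfolding J_def by blast
        ultimately show "0 \<le> q" unfolding abs_less_iff by (simp add: field_simps)
      qed (use J in \<open>auto intro!: continuous_intros continuous_on_subset[OF M(1)]\<close>)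
      have dup: "((\<lambda>v. M v + ?c * v\<^sup>2) has_real_derivative M' v + (f a + \<epsilon>) * v) (at v)"
        and dlo: "((\<lambda>v. ?c' * v\<^sup>2 - M v) has_real_derivative (\<epsilon> - f a) * v - M' v) (at v)" if "v \<in> J" for v
        using that J(3) by (auto intro!: derivative_eq_intros M')
      have key: "M' x + (f a + \<epsilon>) * x \<le> M' y + (f a + \<epsilon>) * y"
        "(\<epsilon> - f a) * x - M' x \<le> (\<epsilon> - f a) * y - M' y" if "x \<in> J" "y \<in> J" "x \<le> y" for x y
        using deriv_mono_if_convex[OF up J(1) that dup dup] deriv_mono_if_convex[OF lo J(1) that dlo dlo] that
        by auto
      have "\<bar>(M' v - M' a) / (v - a) + f a\<bar> \<le> \<epsilon>" if v: "v \<in> J" "v \<noteq> a" for v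
      proof -
        have eq: "(M' v - M' a) / (v - a) + f a = (M' v - M' a + f a * (v - a)) / (v - a)"
          using v(2) by (simp add: field_simps)
        have "\<bar>M' v - M' a + f a * (v - a)\<bar> \<le> \<epsilon> * \<bar>v - a\<bar>"
        proof (cases "v \<le> a")
          case True
          then show ?thesis using key[OF v(1) J(4) True] by (simp add: abs_le_iff algebra_simps)
        next
          case False
          then show ?thesis using key[OF J(4) v(1)] by (simp add: abs_le_iff algebra_simps)
        qed
        then show ?thesis unfolding eq using v(2) by (simp add: abs_divide divide_le_eq)
      qed
      then show ?thesis
        unfolding eventually_at_filter
        using eventually_nhds_in_open[OF J(1,4)] by (auto elim!: eventually_mono)
    qed
    have "((\<lambda>v. (M' v - M' a) / (v - a)) \<longlongrightarrow> - f a) (at a)"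
    proof (rule tendstoI)
      fix \<epsilon> :: real assume "\<epsilon> > 0"
      then show "\<forall>\<^sub>F v in at a. dist ((M' v - M' a) / (v - a)) (- f a) < \<epsilon>"
        using est[of "\<epsilon> / 2"] by (auto simp: dist_real_def elim!: eventually_mono)
    qed
    then show ?thesis unfolding has_field_derivative_iff .
  qed
  show ?thesis
    by (rule C_k_on_2_realI[OF I(1) M' M'']) (auto intro!: continuous_intros f_cont)
qed

text \<open>
A parabola is its own second-order Taylor polynomial, so as a test function it yields the pair
\<open>(p, 2 q)\<close>.
\<close>
lemma viscosity_solution_touching_parabola:
  fixes M :: "real \<Rightarrow> real"
  assumes vs: "viscosity_solution I F M" and a: "a \<in> I" and I: "open I"
  shows "\<forall>\<^sub>F v in nhds a. M v \<le> M a + p * (v - a) + q * (v - a)\<^sup>2 \<Longrightarrow> F a p (2 * q) \<ge> 0"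
    and "\<forall>\<^sub>F v in nhds a. M v \<ge> M a + p * (v - a) + q * (v - a)\<^sup>2 \<Longrightarrow> F a p (2 * q) \<le> 0"
proof -
  define \<phi> where "\<phi> v = M a + p * (v - a) + q * (v - a)\<^sup>2" for v
  have d1: "(\<phi> has_real_derivative p + 2 * q * (v - a)) (at v)" for v
    unfolding \<phi>_def by (auto intro!: derivative_eq_intros)
  have d2: "((\<lambda>v. p + 2 * q * (v - a)) has_real_derivative 2 * q) (at v)" for v
    by (auto intro!: derivative_eq_intros)
  have C2: "C_k_on 2 I \<phi>" by (rule C_k_on_2_realI[OF I d1 d2]) simp
  have der: "deriv \<phi> = (\<lambda>v. p + 2 * q * (v - a))" using DERIV_imp_deriv[OF d1] by blast
  have "deriv \<phi> a = p" "deriv (deriv \<phi>) a = 2 * q" unfolding der using DERIV_imp_deriv[OF d2] by auto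
  moreover have "\<phi> a = M a" by (simp add: \<phi>_def)
  moreover note bspec[OF mp[OF spec[OF conjunct2[OF vs[unfolded viscosity_solution_def]], of \<phi>] C2] a]
  ultimately have *: "((\<forall>\<^sub>F v in nhds a. M v \<le> \<phi> v) \<longrightarrow> F a p (2 * q) \<ge> 0) \<and>
        ((\<forall>\<^sub>F v in nhds a. M v \<ge> \<phi> v) \<longrightarrow> F a p (2 * q) \<le> 0)"
    by simp
  show "\<forall>\<^sub>F v in nhds a. M v \<le> M a + p * (v - a) + q * (v - a)\<^sup>2 \<Longrightarrow> F a p (2 * q) \<ge> 0"
    using * by (simp add: \<phi>_def)
  show "\<forall>\<^sub>F v in nhds a. M v \<ge> M a + p * (v - a) + q * (v - a)\<^sup>2 \<Longrightarrow> F a p (2 * q) \<le> 0"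
    using * by (simp add: \<phi>_def)
qed

section \<open>Smooth bump functions\<close>

text \<open>
The powers in the denominator make the family closed under differentiation up to linear
combinations. At \<open>t \<le> 0\<close> all members vanish, so the junction at \<open>0\<close> is treated once for all of them.
\<close>
definition flat_exp :: "nat \<Rightarrow> real \<Rightarrow> real" where
  "flat_exp j t = (if t \<le> 0 then 0 else exp (- (1 / t)) / t ^ j)"

lemma flat_exp_over_t: "flat_exp j t / t = flat_exp (Suc j) t"
  by (simp add: flat_exp_def)

lemma flat_exp_tendsto_0: "(flat_exp j \<longlongrightarrow> 0) (at 0)"
proof (rule filterlim_split_at)
  show "(flat_exp j \<longlongrightarrow> 0) (at_left 0)"
    by (rule tendsto_eventually) (auto simp: eventually_at_filter flat_exp_def)
  have "((\<lambda>t. inverse t ^ j / exp (inverse t)) \<longlongrightarrow> 0) (at_right (0::real))"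
    by (rule filterlim_compose[OF tendsto_power_div_exp_0 filterlim_inverse_at_top_right])
  moreover have "\<forall>\<^sub>F t in at_right 0. inverse t ^ j / exp (inverse t) = flat_exp j t"
    by (auto simp: eventually_at_filter flat_exp_def exp_minus field_simps)
  ultimately show "(flat_exp j \<longlongrightarrow> 0) (at_right 0)"
    by (rule Lim_transform_eventually)
qed

lemma has_real_derivative_flat_exp:
  "(flat_exp j has_real_derivative flat_exp (j + 2) t - real j * flat_exp (j + 1) t) (at t)"
proof (cases t "0 :: real" rule: linorder_cases)
  case less
  have "(flat_exp j has_real_derivative 0) (at t)"
  proof (rule DERIV_cong_ev[THEN iffD2, OF refl _ refl DERIV_const[of 0]])
    show "\<forall>\<^sub>F x in nhds t. flat_exp j x = 0"
      using eventually_nhds_in_open[of "{..<0}" t] less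
      by (auto simp: flat_exp_def elim!: eventually_mono)
  qed
  then show ?thesis using less by (simp add: flat_exp_def)
next
  case equal
  have "((\<lambda>s. (flat_exp j s - flat_exp j 0) / (s - 0)) \<longlongrightarrow> 0) (at 0)"
    using flat_exp_tendsto_0[of "Suc j"] by (simp add: flat_exp_over_t flat_exp_def[of j 0])
  then show ?thesis
    unfolding equal has_field_derivative_iff by (simp add: flat_exp_def[of _ 0])
next
  case greater
  have "((\<lambda>t. exp (- (1 / t)) / t ^ j) has_real_derivative flat_exp (j + 2) t - real j * flat_exp (j + 1) t) (at t)"
    using greater
    apply (auto intro!: derivative_eq_intros simp: flat_exp_def)
    apply (cases j)
    apply (auto simp: field_simps power2_eq_square)
    done
  moreover have ev: "\<forall>\<^sub>F x in nhds t. flat_exp j x = exp (- (1 / x)) / x ^ j"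
    using eventually_nhds_in_open[of "{0<..}" t] greater
    by (auto simp: flat_exp_def elim!: eventually_mono)
  ultimately show ?thesis using DERIV_cong_ev[OF refl ev refl] by simp
qed

text \<open>
An algebra of functions that contains the bump \<open>exp (- 1 / (r\<^sup>2 - |x - x0|\<^sup>2))\<close> and all of its
iterated partial derivatives. Being closed under partial derivatives, it consists of smooth
functions, and no formula for higher derivatives is ever needed.
\<close>
inductive_set bump_algebra :: "real \<Rightarrow> 'a::euclidean_space \<Rightarrow> ('a \<Rightarrow> real) set"
  for r x0 where
  const: "(\<lambda>_. c) \<in> bump_algebra r x0"
| coord: "(\<lambda>x. x \<bullet> b) \<in> bump_algebra r x0"
| flat: "(\<lambda>x. flat_exp j (r\<^sup>2 - (x - x0) \<bullet> (x - x0))) \<in> bump_algebra r x0"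
| add: "f \<in> bump_algebra r x0 \<Longrightarrow> g \<in> bump_algebra r x0 \<Longrightarrow> (\<lambda>x. f x + g x) \<in> bump_algebra r x0"
| mult: "f \<in> bump_algebra r x0 \<Longrightarrow> g \<in> bump_algebra r x0 \<Longrightarrow> (\<lambda>x. f x * g x) \<in> bump_algebra r x0"

lemma bump_algebra_derivative:
  assumes "f \<in> bump_algebra r x0"
  shows "\<exists>f'. (\<forall>x. (f has_derivative f' x) (at x)) \<and> (\<forall>b. (\<lambda>x. f' x b) \<in> bump_algebra r x0)"
  using assms
proof induction
  case (const c)
  have "(\<lambda>x. 0) \<in> bump_algebra r x0" by (rule bump_algebra.const)
  then show ?case by (intro exI[of _ "\<lambda>_ _. 0"]) auto
next
  case (coord b)
  show ?case
    by (intro exI[of _ "\<lambda>_ h. h \<bullet> b"]) (auto intro!: derivative_eq_intros bump_algebra.const)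
next
  case (flat j)
  define q where "q x = r\<^sup>2 - (x - x0) \<bullet> (x - x0)" for x
  have "((\<lambda>x. flat_exp j (q x)) has_derivative
      (\<lambda>h. (flat_exp (j + 2) (q x) + (- real j) * flat_exp (j + 1) (q x)) * (- 2 * (x \<bullet> h + (- (x0 \<bullet> h)))))) (at x)" for x
  proof -
    have 1: "(q has_derivative (\<lambda>h. - 2 * (x \<bullet> h + (- (x0 \<bullet> h))))) (at x)"
      unfolding q_def by (auto intro!: derivative_eq_intros simp: algebra_simps inner_commute)
    have 2: "(flat_exp j has_derivative (\<lambda>h. (flat_exp (j + 2) (q x) - real j * flat_exp (j + 1) (q x)) * h)) (at (q x))"
      using has_real_derivative_flat_exp unfolding has_field_derivative_def .
    show ?thesis using has_derivative_compose[OF 1 2] by simp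
  qed
  moreover have "(\<lambda>x. (flat_exp (j + 2) (q x) + (- real j) * flat_exp (j + 1) (q x)) * (- 2 * (x \<bullet> h + (- (x0 \<bullet> h))))) \<in> bump_algebra r x0" for h
    unfolding q_def by (intro bump_algebra.intros)
  ultimately show ?case unfolding q_def
    by (intro exI[of _ "\<lambda>x h. (flat_exp (j + 2) (q x) + (- real j) * flat_exp (j + 1) (q x)) * (- 2 * (x \<bullet> h + (- (x0 \<bullet> h))))"]) (simp add: q_def)
next
  case (add f g)
  then obtain f' g' where "\<And>x. (f has_derivative f' x) (at x)" "\<And>b. (\<lambda>x. f' x b) \<in> bump_algebra r x0"
    "\<And>x. (g has_derivative g' x) (at x)" "\<And>b. (\<lambda>x. g' x b) \<in> bump_algebra r x0"
    by metis
  then show ?case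
    by (intro exI[of _ "\<lambda>x h. f' x h + g' x h"]) (auto intro!: derivative_intros bump_algebra.add)
next
  case (mult f g)
  then obtain f' g' where "\<And>x. (f has_derivative f' x) (at x)" "\<And>b. (\<lambda>x. f' x b) \<in> bump_algebra r x0"
    "\<And>x. (g has_derivative g' x) (at x)" "\<And>b. (\<lambda>x. g' x b) \<in> bump_algebra r x0"
    by metis
  with mult.hyps show ?case
    by (intro exI[of _ "\<lambda>x h. f x * g' x h + f' x h * g x"])
      (auto intro!: has_derivative_mult bump_algebra.add bump_algebra.mult)
qed

lemma bump_algebra_C_k_on:
  assumes "f \<in> bump_algebra r x0"
  shows "C_k_on k UNIV f"
  using assms
proof (induction k arbitrary: f)
  case 0
  then obtain f' where "\<And>x. (f has_derivative f' x) (at x)"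
    using bump_algebra_derivative by blast
  then show ?case
    by (auto intro!: continuous_at_imp_continuous_on has_derivative_continuous)
next
  case (Suc k)
  then obtain f' where f': "\<And>x. (f has_derivative f' x) (at x)" "\<And>b. (\<lambda>x. f' x b) \<in> bump_algebra r x0"
    using bump_algebra_derivative[OF Suc.prems] by blast
  have "frechet_derivative f (at x) = f' x" for x
    using frechet_derivative_at[OF f'(1)[of x]] by simp
  then show ?case using Suc.IH[OF f'(2)] f'(1) by (auto simp: differentiable_def)
qed

lemma ex_bump:
  fixes x0 :: "'a::euclidean_space"
  assumes r: "r > 0"
  obtains \<phi> where "\<And>k. C_k_on k UNIV \<phi>" "\<And>x. 0 \<le> \<phi> x" "\<And>x. x \<notin> cball x0 r \<Longrightarrow> \<phi> x = 0" "\<phi> x0 > 0"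
proof
  define \<phi> where "\<phi> x = flat_exp 0 (r\<^sup>2 - (x - x0) \<bullet> (x - x0))" for x
  show "C_k_on k UNIV \<phi>" for k
    unfolding \<phi>_def by (rule bump_algebra_C_k_on[OF bump_algebra.flat])
  show "0 \<le> \<phi> x" for x by (simp add: \<phi>_def flat_exp_def)
  show "\<phi> x0 > 0" using r by (simp add: \<phi>_def flat_exp_def)
  show "\<phi> x = 0" if "x \<notin> cball x0 r" for x
  proof -
    have "r < norm (x - x0)" using that by (simp add: dist_norm norm_minus_commute)
    then have "r\<^sup>2 < (norm (x - x0))\<^sup>2" using r by (intro power_strict_mono) auto
    then show ?thesis by (simp add: \<phi>_def flat_exp_def power2_norm_eq_inner)
  qed
qed

section \<open>Test functions and weak second derivatives\<close>

text \<open>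
The direction comes first, so that derivatives can be iterated.
\<close>
definition dir_deriv :: "'a::euclidean_space \<Rightarrow> ('a \<Rightarrow> real) \<Rightarrow> 'a \<Rightarrow> real" where
  "dir_deriv e \<phi> = (\<lambda>x. frechet_derivative \<phi> (at x) e)"

lemma C_k_on_const: "C_k_on k UNIV (\<lambda>_. c)"
  by (rule bump_algebra_C_k_on[OF bump_algebra.const])

lemma C_k_on_linear_combination:
  assumes "C_k_on k UNIV f" "C_k_on k UNIV g"
  shows "C_k_on k UNIV (\<lambda>x. c * f x + d * g x)"
  using assms
proof (induction k arbitrary: f g)
  case 0
  then show ?case by (auto intro!: continuous_intros)
next
  case (Suc k)
  have d: "((\<lambda>x. c * f x + d * g x) has_derivative
      (\<lambda>h. c * frechet_derivative f (at x) h + d * frechet_derivative g (at x) h)) (at x)" for x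
    using Suc.prems by (auto intro!: derivative_intros simp: frechet_derivative_works[symmetric])
  then have "(\<lambda>x. c * f x + d * g x) differentiable (at x)" for x
    unfolding differentiable_def by blast
  then show ?case
    using Suc frechet_derivative_at[OF d, symmetric] by simp
qed

lemma C_k_on_sum:
  assumes "finite A" "\<And>i. i \<in> A \<Longrightarrow> C_k_on k UNIV (f i)"
  shows "C_k_on k UNIV (\<lambda>x. \<Sum>i\<in>A. c i * f i x)"
  using assms
proof (induction A rule: finite_induct)
  case (insert i A)
  then show ?case using C_k_on_linear_combination[of k "f i" "\<lambda>x. \<Sum>i\<in>A. c i * f i x" "c i" 1] by simp
qed (simp add: C_k_on_const)

lemma frechet_derivative_translate:
  assumes "f differentiable (at (x - a))"
  shows "frechet_derivative (\<lambda>x. f (x - a)) (at x) = frechet_derivative f (at (x - a))"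
    and "(\<lambda>x. f (x - a)) differentiable (at x)"
proof -
  have "((\<lambda>x. x - a) has_derivative (\<lambda>h. h)) (at x)" by (auto intro!: derivative_eq_intros)
  then have d: "((\<lambda>x. f (x - a)) has_derivative frechet_derivative f (at (x - a))) (at x)"
    using has_derivative_compose[of "\<lambda>x. x - a" "\<lambda>h. h"] assms by (simp add: frechet_derivative_works)
  show "frechet_derivative (\<lambda>x. f (x - a)) (at x) = frechet_derivative f (at (x - a))"
    using frechet_derivative_at[OF d] by simp
  show "(\<lambda>x. f (x - a)) differentiable (at x)" using d by (auto simp: differentiable_def)
qed

lemma C_k_on_translate:
  assumes "C_k_on k UNIV f"
  shows "C_k_on k UNIV (\<lambda>x. f (x - a))"
  using assms
proof (induction k arbitrary: f)
  case 0
  then show ?case by (auto intro!: continuous_on_compose2[of UNIV f UNIV "\<lambda>x. x - a"] continuous_intros)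
next
  case (Suc k)
  then show ?case
    using frechet_derivative_translate[of f _ a] Suc.IH[of "\<lambda>x. frechet_derivative f (at x) b" for b] by simp
qed

lemma test_function_has_derivative:
  assumes "test_function S \<phi>"
  shows "(\<phi> has_derivative frechet_derivative \<phi> (at x)) (at x)"
proof -
  have "C_k_on (Suc 0) UNIV \<phi>" using assms unfolding test_function_def by blast
  then show ?thesis by (simp add: frechet_derivative_works)
qed

text \<open>
Weak derivatives are only given for basis directions; this reduces a general direction to them.
\<close>
lemma dir_deriv_eq_sum:
  assumes "test_function S \<phi>"
  shows "dir_deriv e \<phi> x = (\<Sum>b\<in>Basis. (e \<bullet> b) * dir_deriv b \<phi> x)"
proof -
  have l: "linear (frechet_derivative \<phi> (at x))"
    using test_function_has_derivative[OF assms] has_derivative_linear by blast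
  have "frechet_derivative \<phi> (at x) e = frechet_derivative \<phi> (at x) (\<Sum>b\<in>Basis. (e \<bullet> b) *\<^sub>R b)"
    by (simp only: euclidean_representation)
  then show ?thesis by (simp add: dir_deriv_def linear_sum[OF l] linear_scale[OF l])
qed

lemma test_function_dir_deriv:
  assumes "test_function S \<phi>"
  shows "test_function S (dir_deriv e \<phi>)"
proof -
  have b: "C_k_on k UNIV (dir_deriv b \<phi>)" if "b \<in> Basis" for b k
  proof -
    have "C_k_on (Suc k) UNIV \<phi>" using assms unfolding test_function_def by blast
    then show ?thesis using that by (simp add: dir_deriv_def)
  qed
  have "dir_deriv e \<phi> = (\<lambda>x. \<Sum>b\<in>Basis. (e \<bullet> b) * dir_deriv b \<phi> x)"
    using dir_deriv_eq_sum[OF assms] by blast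
  moreover have "C_k_on k UNIV (\<lambda>x. \<Sum>b\<in>Basis. (e \<bullet> b) * dir_deriv b \<phi> x)" for k
    by (rule C_k_on_sum) (simp_all add: b)
  ultimately have 1: "C_k_on k UNIV (dir_deriv e \<phi>)" for k by metis
  obtain C where C: "compact C" "C \<subseteq> S" "\<And>x. x \<notin> C \<Longrightarrow> \<phi> x = 0"
    using assms unfolding test_function_def by blast
  have "dir_deriv e \<phi> x = 0" if x: "x \<notin> C" for x
  proof -
    have "(\<phi> has_derivative (\<lambda>_. 0)) (at x)"
    proof (rule has_derivative_transform_within_open[of "\<lambda>_. 0"])
      show "open (- C)" using C(1) by (simp add: compact_imp_closed open_Compl)
    qed (use x C in auto)
    from frechet_derivative_at[OF this] show ?thesis by (metis dir_deriv_def)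
  qed
  then show ?thesis using 1 C unfolding test_function_def by blast
qed

lemma test_function_continuous:
  assumes "test_function S \<phi>"
  shows "continuous_on X \<phi>"
  using has_derivative_continuous[OF test_function_has_derivative[OF assms]]
  by (intro continuous_at_imp_continuous_on) blast

lemma test_function_bounded:
  assumes "test_function S \<phi>"
  obtains B where "B \<ge> 0" "\<And>x. \<bar>\<phi> x\<bar> \<le> B"
proof -
  obtain C where C: "compact C" "\<And>x. x \<notin> C \<Longrightarrow> \<phi> x = 0"
    using assms unfolding test_function_def by blast
  obtain B where "B \<ge> 0" "\<And>x. x \<in> C \<Longrightarrow> norm (\<phi> x) \<le> B"
    using continuous_on_compact_bound[OF C(1) test_function_continuous[OF assms]] by blast
  then show thesis using that[of B] C(2) by (metis abs_zero real_norm_def)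
qed

lemma test_function_integrable:
  assumes "test_function S \<phi>"
  shows "integrable lborel \<phi>"
proof -
  obtain C where C: "compact C" "\<And>x. x \<notin> C \<Longrightarrow> \<phi> x = 0"
    using assms unfolding test_function_def by blast
  have "integrable lborel (\<lambda>x. indicator C x *\<^sub>R \<phi> x)"
    by (rule borel_integrable_compact[OF C(1) test_function_continuous[OF assms]])
  moreover have "(\<lambda>x. indicator C x *\<^sub>R \<phi> x) = \<phi>"
    by (rule ext) (use C(2) in \<open>auto simp: indicator_def\<close>)
  ultimately show ?thesis by simp
qed

lemma test_function_measurable:
  assumes "test_function S \<phi>"
  shows "\<phi> \<in> borel_measurable (lebesgue_on T)"
proof -
  have "\<phi> \<in> borel_measurable borel" using test_function_integrable[OF assms] by auto
  then show ?thesis by (simp add: measurable_restrict_space1 measurable_completion)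
qed

lemma test_function_translate:
  assumes "test_function S \<phi>" "(\<lambda>x. x + a) ` S \<subseteq> T"
  shows "test_function T (\<lambda>x. \<phi> (x - a))"
proof -
  obtain C where C: "compact C" "C \<subseteq> S" "\<And>x. x \<notin> C \<Longrightarrow> \<phi> x = 0"
    using assms unfolding test_function_def by blast
  have "compact ((\<lambda>x. x + a) ` C)" using C(1) by (intro compact_continuous_image continuous_intros)
  moreover have "\<phi> (x - a) = 0" if "x \<notin> (\<lambda>x. x + a) ` C" for x
    using C(3)[of "x - a"] that by (metis diff_add_cancel imageI)
  ultimately show ?thesis
    using assms C(2) unfolding test_function_def by (auto intro!: C_k_on_translate exI[of _ "(\<lambda>x. x + a) ` C"])
qed

lemma dir_deriv_translate:
  assumes "test_function S \<phi>"
  shows "dir_deriv e (\<lambda>x. \<phi> (x - a)) = (\<lambda>x. dir_deriv e \<phi> (x - a))"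
  using frechet_derivative_translate(1)[of \<phi> _ a] test_function_has_derivative[OF assms]
  unfolding dir_deriv_def differentiable_def by (auto simp: fun_eq_iff)

lemma integrable_mult_bounded:
  fixes u \<phi> :: "'a \<Rightarrow> real"
  assumes u: "integrable M u" and \<phi>: "\<phi> \<in> borel_measurable M" and B: "AE x in M. \<bar>\<phi> x\<bar> \<le> B"
  shows "integrable M (\<lambda>x. u x * \<phi> x)"
proof (rule Bochner_Integration.integrable_bound)
  show "integrable M (\<lambda>x. B * u x)" using u by simp
  show "(\<lambda>x. u x * \<phi> x) \<in> borel_measurable M" using u \<phi> by measurable
  show "AE x in M. norm (u x * \<phi> x) \<le> norm (B * u x)"
    using B
  proof eventually_elim
    case (elim x)
    then have "\<bar>\<phi> x\<bar> * \<bar>u x\<bar> \<le> \<bar>B\<bar> * \<bar>u x\<bar>" by (intro mult_right_mono) auto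
    then show ?case by (simp add: abs_mult mult.commute)
  qed
qed

lemma integrable_mult_test_function:
  assumes u: "integrable (lebesgue_on T) u" and \<phi>: "test_function S \<phi>"
  shows "integrable (lebesgue_on T) (\<lambda>x. u x * \<phi> x)"
proof -
  obtain B where "\<And>x. \<bar>\<phi> x\<bar> \<le> B" using test_function_bounded[OF \<phi>] by blast
  then show ?thesis by (intro integrable_mult_bounded[OF u test_function_measurable[OF \<phi>]]) auto
qed

lemma Lp_on_infinity_bound:
  assumes "Lp_on \<infinity> S u"
  obtains C where "C \<ge> 0" "AE x in lebesgue_on S. \<bar>u x\<bar> \<le> C"
proof -
  obtain C where "AE x in lebesgue_on S. \<bar>u x\<bar> \<le> C" using assms unfolding Lp_on_def by auto
  then have "AE x in lebesgue_on S. \<bar>u x\<bar> \<le> max C 0" by eventually_elim auto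
  then show thesis using that[of "max C 0"] by simp
qed

lemma Lp_on_infinity_integrable:
  assumes "Lp_on \<infinity> S u" "S \<in> lmeasurable"
  shows "integrable (lebesgue_on S) u"
proof -
  interpret finite_measure "lebesgue_on S"
    using assms(2) by (rule finite_measure_lebesgue_on)
  obtain C where "AE x in lebesgue_on S. \<bar>u x\<bar> \<le> C" using Lp_on_infinity_bound[OF assms(1)] by blast
  then show ?thesis using assms(1) by (intro integrable_const_bound[of _ C]) (auto simp: Lp_on_def)
qed

text \<open>
Moving both derivatives from the test function to \<open>V\<close> turns the integral into the integral of an
essentially bounded function against \<open>\<phi>\<close>.
\<close>
lemma sobolev_2_infinity_weak_bound_Basis:
  assumes S: "S \<in> lmeasurable" and V: "sobolev 2 \<infinity> S V" and b: "b \<in> Basis" "b' \<in> Basis"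
  shows "\<exists>C\<ge>0. \<forall>\<phi>. test_function S \<phi> \<longrightarrow> (\<forall>x. 0 \<le> \<phi> x) \<longrightarrow>
    \<bar>LINT x|lebesgue_on S. V x * dir_deriv b (dir_deriv b' \<phi>) x\<bar> \<le> C * (LINT x|lebesgue_on S. \<phi> x)"
proof -
  obtain g g' where g: "weak_deriv S b V g" and g': "weak_deriv S b' g g'" "Lp_on \<infinity> S g'"
    using V b unfolding numeral_2_eq_2 by (auto, blast)
  obtain C where C: "C \<ge> 0" "AE x in lebesgue_on S. \<bar>g' x\<bar> \<le> C" using Lp_on_infinity_bound[OF g'(2)] by blast
  show ?thesis
  proof (intro exI[of _ C] conjI allI impI C(1))
    fix \<phi> assume \<phi>: "test_function S \<phi>" "\<forall>x. 0 \<le> \<phi> x"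
    have "(LINT x|lebesgue_on S. V x * dir_deriv b (dir_deriv b' \<phi>) x) = - (LINT x|lebesgue_on S. g x * dir_deriv b' \<phi> x)"
      using g test_function_dir_deriv[OF \<phi>(1)] unfolding weak_deriv_def dir_deriv_def by blast
    also have "\<dots> = (LINT x|lebesgue_on S. g' x * \<phi> x)"
      using g' \<phi>(1) unfolding weak_deriv_def dir_deriv_def by simp
    finally have eq: "(LINT x|lebesgue_on S. V x * dir_deriv b (dir_deriv b' \<phi>) x) = (LINT x|lebesgue_on S. g' x * \<phi> x)" .
    have i: "integrable (lebesgue_on S) (\<lambda>x. g' x * \<phi> x)"
      by (rule integrable_mult_test_function[OF Lp_on_infinity_integrable[OF g'(2) S] \<phi>(1)])
    have i': "integrable (lebesgue_on S) \<phi>"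
    proof -
      have "integrable lebesgue \<phi>" using test_function_integrable[OF \<phi>(1)] by (simp add: integrable_completion)
      then have "integrable lebesgue (\<lambda>x. indicator S x *\<^sub>R \<phi> x)"
        using S by (intro integrable_mult_indicator) (auto simp: fmeasurable_def)
      then show ?thesis using S by (subst integrable_restrict_space) auto
    qed
    have "\<bar>LINT x|lebesgue_on S. g' x * \<phi> x\<bar> \<le> (LINT x|lebesgue_on S. C * \<phi> x)"
    proof (rule integral_abs_bound[THEN order_trans], rule integral_mono_AE)
      show "AE x in lebesgue_on S. \<bar>g' x * \<phi> x\<bar> \<le> C * \<phi> x"
        using C(2) by eventually_elim (use \<phi>(2) in \<open>auto simp: abs_mult intro!: mult_right_mono\<close>)
    qed (use i i' in auto)
    then show "\<bar>LINT x|lebesgue_on S. V x * dir_deriv b (dir_deriv b' \<phi>) x\<bar> \<le> C * (LINT x|lebesgue_on S. \<phi> x)"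
      unfolding eq by simp
  qed
qed

lemma sobolev_2_infinity_weak_bound:
  fixes V :: "'a::euclidean_space \<Rightarrow> real"
  assumes S: "S \<in> lmeasurable" and V: "sobolev 2 \<infinity> S V"
  obtains C where "C \<ge> 0" "\<And>\<phi>. test_function S \<phi> \<Longrightarrow> (\<And>x. 0 \<le> \<phi> x) \<Longrightarrow>
    \<bar>LINT x|lebesgue_on S. V x * dir_deriv e (dir_deriv e \<phi>) x\<bar> \<le> C * (LINT x|lebesgue_on S. \<phi> x)"
proof -
  have "\<forall>b\<in>Basis. \<forall>b'\<in>Basis. \<exists>C\<ge>0. \<forall>\<phi>. test_function S \<phi> \<longrightarrow> (\<forall>x. 0 \<le> \<phi> x) \<longrightarrow>
    \<bar>LINT x|lebesgue_on S. V x * dir_deriv b (dir_deriv b' \<phi>) x\<bar> \<le> C * (LINT x|lebesgue_on S. \<phi> x)"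
    using sobolev_2_infinity_weak_bound_Basis[OF S V] by blast
  then obtain c where c: "\<And>b b'. b \<in> Basis \<Longrightarrow> b' \<in> Basis \<Longrightarrow> c b b' \<ge> 0"
    "\<And>b b' \<phi>. b \<in> Basis \<Longrightarrow> b' \<in> Basis \<Longrightarrow> test_function S \<phi> \<Longrightarrow> (\<And>x. 0 \<le> \<phi> x) \<Longrightarrow>
    \<bar>LINT x|lebesgue_on S. V x * dir_deriv b (dir_deriv b' \<phi>) x\<bar> \<le> c b b' * (LINT x|lebesgue_on S. \<phi> x)"
    by metis
  define C where "C = (\<Sum>b\<in>Basis. \<Sum>b'\<in>Basis. \<bar>e \<bullet> b\<bar> * \<bar>e \<bullet> b'\<bar> * c b' b)"
  show thesis
  proof
    show "C \<ge> 0" unfolding C_def using c(1) by (auto intro!: sum_nonneg)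
    fix \<phi> assume \<phi>: "test_function S \<phi>" "\<And>x. 0 \<le> \<phi> x"
    have "Lp_on \<infinity> S V" using V unfolding numeral_2_eq_2 by simp
    then have iV: "integrable (lebesgue_on S) V" using Lp_on_infinity_integrable S by blast
    have i: "integrable (lebesgue_on S) (\<lambda>x. V x * dir_deriv b' (dir_deriv b \<phi>) x)" for b b'
      by (rule integrable_mult_test_function[OF iV test_function_dir_deriv[OF test_function_dir_deriv[OF \<phi>(1)]]])
    have DD: "dir_deriv e (dir_deriv e \<phi>) x = (\<Sum>b\<in>Basis. \<Sum>b'\<in>Basis. ((e \<bullet> b) * (e \<bullet> b')) * dir_deriv b' (dir_deriv b \<phi>) x)" for x
    proof -
      let ?D = "\<lambda>b. frechet_derivative (dir_deriv b \<phi>) (at x)"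
      have "((\<lambda>x. \<Sum>b\<in>Basis. (e \<bullet> b) * dir_deriv b \<phi> x) has_derivative (\<lambda>h. \<Sum>b\<in>Basis. (e \<bullet> b) * ?D b h)) (at x)"
        by (intro derivative_intros test_function_has_derivative[OF test_function_dir_deriv[OF \<phi>(1)]])
      then have "(dir_deriv e \<phi> has_derivative (\<lambda>h. \<Sum>b\<in>Basis. (e \<bullet> b) * ?D b h)) (at x)"
        by (subst ext[OF dir_deriv_eq_sum[OF \<phi>(1)]])
      note D = frechet_derivative_at[OF this, symmetric]
      have "dir_deriv e (dir_deriv e \<phi>) x = (\<Sum>b\<in>Basis. (e \<bullet> b) * dir_deriv e (dir_deriv b \<phi>) x)"
        unfolding dir_deriv_def[of e "dir_deriv e \<phi>"] D by (simp add: dir_deriv_def)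
      also have "\<dots> = (\<Sum>b\<in>Basis. (e \<bullet> b) * (\<Sum>b'\<in>Basis. (e \<bullet> b') * dir_deriv b' (dir_deriv b \<phi>) x))"
        by (subst dir_deriv_eq_sum[OF test_function_dir_deriv[OF \<phi>(1)]]) simp
      finally show ?thesis by (simp add: sum_distrib_left mult.assoc)
    qed
    have "(LINT x|lebesgue_on S. V x * dir_deriv e (dir_deriv e \<phi>) x) =
      (LINT x|lebesgue_on S. (\<Sum>b\<in>Basis. \<Sum>b'\<in>Basis. ((e \<bullet> b) * (e \<bullet> b')) * (V x * dir_deriv b' (dir_deriv b \<phi>) x)))"
      unfolding DD by (simp add: sum_distrib_left mult_ac)
    also have "\<dots> = (\<Sum>b\<in>Basis. \<Sum>b'\<in>Basis. ((e \<bullet> b) * (e \<bullet> b')) * (LINT x|lebesgue_on S. V x * dir_deriv b' (dir_deriv b \<phi>) x))"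
      using i by simp
    also have "\<bar>\<dots>\<bar> \<le> (\<Sum>b\<in>Basis. \<Sum>b'\<in>Basis. \<bar>((e \<bullet> b) * (e \<bullet> b')) * (LINT x|lebesgue_on S. V x * dir_deriv b' (dir_deriv b \<phi>) x)\<bar>)"
      by (intro order_trans[OF sum_abs] sum_mono sum_abs)
    also have "\<dots> \<le> (\<Sum>b\<in>Basis. \<Sum>b'\<in>Basis. \<bar>e \<bullet> b\<bar> * \<bar>e \<bullet> b'\<bar> * (c b' b * (LINT x|lebesgue_on S. \<phi> x)))"
      unfolding abs_mult using c(2)[OF _ _ \<phi>] by (intro sum_mono mult_left_mono) auto
    also have "\<dots> = C * (LINT x|lebesgue_on S. \<phi> x)"
      unfolding C_def sum_distrib_right by (simp only: mult.assoc)
    finally show "\<bar>LINT x|lebesgue_on S. V x * dir_deriv e (dir_deriv e \<phi>) x\<bar> \<le> C * (LINT x|lebesgue_on S. \<phi> x)" .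
  qed
qed

text \<open>
Second-order Taylor bound along a line, uniform in the base point; the sign of the linear term
comes from the shift by \<open>- k e\<close>.
\<close>
lemma test_function_taylor:
  assumes \<phi>: "test_function S \<phi>" and B: "\<And>x. \<bar>dir_deriv e (dir_deriv e \<phi>) x\<bar> \<le> B"
  shows "\<bar>\<phi> (y - k *\<^sub>R e) - \<phi> y + k * dir_deriv e \<phi> y\<bar> \<le> B * k\<^sup>2"
proof -
  have d: "((\<lambda>s. f (y - s *\<^sub>R e)) has_real_derivative - dir_deriv e f (y - s *\<^sub>R e)) (at s)"
    if f: "test_function S f" for f s
  proof -
    have l: "linear (frechet_derivative f (at x))" for x
      using test_function_has_derivative[OF f] has_derivative_linear by blast
    have "((\<lambda>s. y - s *\<^sub>R e) has_derivative (\<lambda>h. - (h *\<^sub>R e))) (at s)"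
      by (auto intro!: derivative_eq_intros)
    from has_derivative_compose[OF this test_function_has_derivative[OF f]]
    show ?thesis
      unfolding has_field_derivative_def dir_deriv_def
      by (rule has_derivative_eq_rhs) (simp add: linear_neg[OF l] linear_scale[OF l] fun_eq_iff mult.commute)
  qed
  have 1: "\<bar>dir_deriv e \<phi> (y - s *\<^sub>R e) - dir_deriv e \<phi> (y - 0 *\<^sub>R e)\<bar> \<le> B * \<bar>s - 0\<bar>" for s
    using field_differentiable_bound[of UNIV "\<lambda>s. dir_deriv e \<phi> (y - s *\<^sub>R e)"
        "\<lambda>s. - dir_deriv e (dir_deriv e \<phi>) (y - s *\<^sub>R e)" B 0 s]
      d[OF test_function_dir_deriv[OF \<phi>]] B by simp
  have "\<bar>(\<phi> (y - k *\<^sub>R e) + k * dir_deriv e \<phi> y) - (\<phi> (y - 0 *\<^sub>R e) + 0 * dir_deriv e \<phi> y)\<bar> \<le> (B * \<bar>k\<bar>) * \<bar>k - 0\<bar>"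
    unfolding real_norm_def[symmetric]
  proof (rule field_differentiable_bound[of "cball 0 \<bar>k\<bar>"])
    fix s :: real assume s: "s \<in> cball 0 \<bar>k\<bar>"
    show "((\<lambda>s. \<phi> (y - s *\<^sub>R e) + s * dir_deriv e \<phi> y) has_field_derivative
        (- dir_deriv e \<phi> (y - s *\<^sub>R e) + dir_deriv e \<phi> y)) (at s within cball 0 \<bar>k\<bar>)"
      by (auto intro!: derivative_eq_intros has_field_derivative_at_within[OF d[OF \<phi>]])
    have "B \<ge> 0" using order_trans[OF abs_ge_zero B] .
    then have "B * \<bar>s\<bar> \<le> B * \<bar>k\<bar>" using s by (intro mult_left_mono) auto
    then show "norm (- dir_deriv e \<phi> (y - s *\<^sub>R e) + dir_deriv e \<phi> y) \<le> B * norm k"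
      using 1[of s] by simp
  qed auto
  then show ?thesis by (simp add: power2_eq_square abs_mult_self_eq mult.assoc)
qed

text \<open>
The Taylor bound holds uniformly in \<open>x\<close>, so integrating it against \<open>u\<close> leaves a quadratic error
in the increment of \<open>h\<close>.
\<close>
lemma has_real_derivative_integral_shifted_test_function:
  assumes u: "integrable (lebesgue_on T) u" and \<phi>: "test_function S \<phi>"
  shows "((\<lambda>h. LINT x|lebesgue_on T. u x * \<phi> (x - h *\<^sub>R e)) has_real_derivative
     - (LINT x|lebesgue_on T. u x * dir_deriv e \<phi> (x - h *\<^sub>R e))) (at h)"
proof -
  obtain B where B: "\<And>x. \<bar>dir_deriv e (dir_deriv e \<phi>) x\<bar> \<le> B"
    using test_function_bounded[OF test_function_dir_deriv[OF test_function_dir_deriv[OF \<phi>]]] by blast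
  have i: "integrable (lebesgue_on T) (\<lambda>x. u x * f (x - a))" if "test_function S f" for f a
    by (rule integrable_mult_test_function[OF u test_function_translate[OF that order.refl]])
  note i1 = i[OF \<phi>] and i2 = i[OF test_function_dir_deriv[OF \<phi>]]
  show ?thesis
  proof (rule has_real_derivative_if_quadratic_error[of 1])
    fix s
    let ?I = "\<lambda>f. LINT x|lebesgue_on T. f x"
    let ?r = "\<lambda>x. \<phi> (x - s *\<^sub>R e) - \<phi> (x - h *\<^sub>R e) + (s - h) * dir_deriv e \<phi> (x - h *\<^sub>R e)"
    have "?I (\<lambda>x. u x * \<phi> (x - s *\<^sub>R e)) - ?I (\<lambda>x. u x * \<phi> (x - h *\<^sub>R e))
        - (- ?I (\<lambda>x. u x * dir_deriv e \<phi> (x - h *\<^sub>R e))) * (s - h)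
      = ?I (\<lambda>x. u x * \<phi> (x - s *\<^sub>R e)) - ?I (\<lambda>x. u x * \<phi> (x - h *\<^sub>R e))
        + ?I (\<lambda>x. (s - h) * (u x * dir_deriv e \<phi> (x - h *\<^sub>R e)))"
      by simp
    also have "\<dots> = ?I (\<lambda>x. u x * \<phi> (x - s *\<^sub>R e) - u x * \<phi> (x - h *\<^sub>R e)
        + (s - h) * (u x * dir_deriv e \<phi> (x - h *\<^sub>R e)))"
      by (subst Bochner_Integration.integral_add Bochner_Integration.integral_diff;
          (intro Bochner_Integration.integrable_diff integrable_mult_right i1 i2)?)+ simp
    also have "\<dots> = ?I (\<lambda>x. u x * ?r x)"
      by (intro Bochner_Integration.integral_cong) (simp_all add: algebra_simps)
    also have "\<bar>\<dots>\<bar> \<le> ?I (\<lambda>x. (B * (s - h)\<^sup>2) * \<bar>u x\<bar>)"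
    proof (rule integral_abs_bound[THEN order_trans], rule integral_mono_AE)
      have "integrable (lebesgue_on T) (\<lambda>x. u x * \<phi> (x - s *\<^sub>R e) - u x * \<phi> (x - h *\<^sub>R e)
        + (s - h) * (u x * dir_deriv e \<phi> (x - h *\<^sub>R e)))"
        by (intro Bochner_Integration.integrable_add Bochner_Integration.integrable_diff integrable_mult_right i1 i2)
      then have "integrable (lebesgue_on T) (\<lambda>x. u x * ?r x)" by (simp add: algebra_simps)
      then show "integrable (lebesgue_on T) (\<lambda>x. \<bar>u x * ?r x\<bar>)" by simp
      show "integrable (lebesgue_on T) (\<lambda>x. (B * (s - h)\<^sup>2) * \<bar>u x\<bar>)" using u by simp
      have "\<bar>?r x\<bar> \<le> B * (s - h)\<^sup>2" for x
        using test_function_taylor[OF \<phi> B, of "x - h *\<^sub>R e" "s - h"] by (simp add: algebra_simps)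
      then have "\<bar>u x * ?r x\<bar> \<le> (B * (s - h)\<^sup>2) * \<bar>u x\<bar>" for x
        unfolding abs_mult by (subst mult.commute) (intro mult_right_mono, auto)
      then show "AE x in lebesgue_on T. \<bar>u x * ?r x\<bar> \<le> (B * (s - h)\<^sup>2) * \<bar>u x\<bar>" by blast
    qed
    also have "\<dots> = (B * ?I (\<lambda>x. \<bar>u x\<bar>)) * (s - h)\<^sup>2" by simp
    finally show "\<bar>?I (\<lambda>x. u x * \<phi> (x - s *\<^sub>R e)) - ?I (\<lambda>x. u x * \<phi> (x - h *\<^sub>R e))
        - (- ?I (\<lambda>x. u x * dir_deriv e \<phi> (x - h *\<^sub>R e))) * (s - h)\<bar> \<le> (B * ?I (\<lambda>x. \<bar>u x\<bar>)) * (s - h)\<^sup>2" .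
  qed simp
qed

lemma integral_shifted_test_function:
  assumes \<phi>: "test_function T \<phi>" and S: "S \<in> sets lebesgue" and supp: "\<And>x. x \<notin> S \<Longrightarrow> \<phi> (x - a) = 0"
  shows "(LINT x|lebesgue_on S. \<phi> (x - a)) = (LINT x|lborel. \<phi> x)"
proof -
  have m: "\<phi> \<in> borel_measurable borel" using test_function_integrable[OF \<phi>] by auto
  have "(LINT x|lebesgue_on S. \<phi> (x - a)) = (LINT x|lebesgue. indicator S x *\<^sub>R \<phi> (x - a))"
    using S by (subst integral_restrict_space) auto
  also have "\<dots> = (LINT x|lebesgue. \<phi> (x - a))"
    using supp by (intro Bochner_Integration.integral_cong) (auto simp: indicator_def)
  also have "\<dots> = (LINT x|lborel. \<phi> (x - a))"
    using m by (intro integral_completion measurable_compose[OF _ m]) measurable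
  also have "\<dots> = (LINT x|distr lborel borel ((+) (- a)). \<phi> x)"
    using m by (subst integral_distr) auto
  finally show ?thesis by (simp only: lborel_distr_plus)
qed

text \<open>
Otherwise the nonempty open set where \<open>\<phi>\<close> is positive would be a null set.
\<close>
lemma test_function_integral_pos:
  assumes \<phi>: "test_function S \<phi>" and nn: "\<And>x. 0 \<le> \<phi> x" and pos: "\<phi> x0 > 0"
  shows "(LINT x|lborel. \<phi> x) > 0"
proof (rule ccontr)
  assume "\<not> ?thesis"
  moreover have "(LINT x|lborel. \<phi> x) \<ge> 0" using nn by simp
  ultimately have "(LINT x|lborel. \<phi> x) = 0" by linarith
  then have "AE x in lborel. \<phi> x = 0"
    using integral_nonneg_eq_0_iff_AE[OF test_function_integrable[OF \<phi>] AE_I2] nn by blast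
  then have "{x. \<phi> x > 0} \<in> null_sets lborel"
    using test_function_integrable[OF \<phi>] by (subst AE_iff_null_sets) (auto elim: eventually_mono)
  then have "negligible {x. \<phi> x > 0}"
    by (simp add: negligible_iff_null_sets null_sets_completionI)
  moreover have "open {x. \<phi> x > 0}"
    using test_function_continuous[OF \<phi>, of UNIV] by (intro open_Collect_less continuous_on_const)
  ultimately show False using open_not_negligible pos by blast
qed

lemma ex_localized_bump:
  fixes x0 :: "'a::euclidean_space"
  assumes "r > 0"
  obtains \<phi> where "test_function (cball x0 r) \<phi>" "\<And>x. 0 \<le> \<phi> x" "\<And>x. x \<notin> cball x0 r \<Longrightarrow> \<phi> x = 0"
    "(LINT x|lborel. \<phi> x) > 0"
proof -
  obtain \<phi> where \<phi>: "\<And>k. C_k_on k UNIV \<phi>" "\<And>x. 0 \<le> \<phi> x" "\<And>x. x \<notin> cball x0 r \<Longrightarrow> \<phi> x = 0" "\<phi> x0 > 0"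
    using ex_bump[OF assms, of x0] by blast
  then have tf: "test_function (cball x0 r) \<phi>"
    unfolding test_function_def by (intro conjI allI exI[of _ "cball x0 r"]) auto
  show thesis
    by (rule that[OF tf \<phi>(2,3) test_function_integral_pos[OF tf \<phi>(2), of x0]]) (auto intro: \<phi>(4))
qed

section \<open>Semiconvexity of functions with bounded weak second derivatives\<close>

text \<open>
For a bump \<open>\<phi>\<close> near \<open>x0\<close> of mass \<open>N\<close>, the average \<open>\<Phi> h = \<integral> V(x) \<phi>(x - h e) dx\<close> is twice
differentiable in \<open>h\<close> with \<open>|\<Phi>''| \<le> C N\<close> by the weak bound, whatever the width of the bump. So
\<open>C N h\<^sup>2 \<plusminus> \<Phi> h\<close> is convex. Shrinking the bump turns \<open>\<Phi> / N\<close> into the point values of the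
continuous function \<open>V\<close>. A convexity inequality involves only three points, so pointwise convergence
suffices. The constant is chosen before the base point \<open>x0\<close>, which makes the inequalities uniform
in parallel lines.
\<close>
theorem sobolev_2_infinity_semiconvex:
  fixes V :: "'a::euclidean_space \<Rightarrow> real"
  assumes S: "open S" "convex S" "bounded S" and V: "sobolev 2 \<infinity> S V" "continuous_on S V"
  obtains C where "C \<ge> 0"
    "\<And>\<sigma> x0. \<sigma> \<in> {1, - 1} \<Longrightarrow> convex_on {s. x0 + s *\<^sub>R e \<in> S} (\<lambda>s. C * s\<^sup>2 + \<sigma> * V (x0 + s *\<^sub>R e))"
proof -
  have lm: "S \<in> lmeasurable" using S bounded_set_imp_lmeasurable lmeasurable_open by blast
  have iV: "integrable (lebesgue_on S) V"
    using Lp_on_infinity_integrable[OF _ lm] V(1) unfolding numeral_2_eq_2 by simp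
  obtain C where C: "C \<ge> 0" "\<And>\<phi>. test_function S \<phi> \<Longrightarrow> (\<And>x. 0 \<le> \<phi> x) \<Longrightarrow>
    \<bar>LINT x|lebesgue_on S. V x * dir_deriv e (dir_deriv e \<phi>) x\<bar> \<le> C * (LINT x|lebesgue_on S. \<phi> x)"
    using sobolev_2_infinity_weak_bound[OF lm V(1)] by blast
  have "convex_on {s. x0 + s *\<^sub>R e \<in> S} (\<lambda>s. C * s\<^sup>2 + \<sigma> * V (x0 + s *\<^sub>R e))" if \<sigma>: "\<sigma> \<in> {1, - 1}" for \<sigma> :: real and x0
  proof (rule convex_onI)
    define \<gamma> where "\<gamma> s = x0 + s *\<^sub>R e" for s
    show J: "convex {s. x0 + s *\<^sub>R e \<in> S}"
    proof (rule convexI)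
      fix s t u v :: real assume "s \<in> {s. x0 + s *\<^sub>R e \<in> S}" "t \<in> {s. x0 + s *\<^sub>R e \<in> S}" "0 \<le> u" "0 \<le> v" "u + v = 1"
      moreover from this have "x0 + (u *\<^sub>R s + v *\<^sub>R t) *\<^sub>R e = u *\<^sub>R (x0 + s *\<^sub>R e) + v *\<^sub>R (x0 + t *\<^sub>R e)"
        by (simp add: scaleR_add_left scaleR_add_right algebra_simps flip: scaleR_add_left)
      ultimately show "u *\<^sub>R s + v *\<^sub>R t \<in> {s. x0 + s *\<^sub>R e \<in> S}" using convexD[OF S(2)] by simp
    qed
    fix t s1 s2 :: real assume t: "0 < t" "t < 1" and s: "s1 \<in> {s. x0 + s *\<^sub>R e \<in> S}" "s2 \<in> {s. x0 + s *\<^sub>R e \<in> S}"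
    define I where "I = closed_segment s1 s2"
    define s3 where "s3 = (1 - t) *\<^sub>R s1 + t *\<^sub>R s2"
    have sI: "s1 \<in> I" "s2 \<in> I" by (auto simp: I_def)
    have "s3 \<in> I" unfolding I_def s3_def closed_segment_def using t by auto
    note sI = sI this
    have "I \<subseteq> {s. x0 + s *\<^sub>R e \<in> S}" unfolding I_def by (rule closed_segment_subset[OF s J])
    then have sub: "\<gamma> ` I \<subseteq> S" by (auto simp: \<gamma>_def)
    have "compact (\<gamma> ` I)" unfolding \<gamma>_def I_def by (intro compact_continuous_image continuous_intros compact_segment)
    \<comment> \<open>Bumps of radius below \<open>r\<close> can be moved along the whole segment without leaving \<open>S\<close>.\<close>
    then obtain r where r: "r > 0" "(\<Union>x\<in>\<gamma> ` I. cball x r) \<subseteq> S"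
      using compact_subset_open_imp_cball_epsilon_subset[OF _ S(1) sub] by blast
    let ?U = "\<lambda>s. C * s\<^sup>2 + \<sigma> * V (\<gamma> s)"
    have "?U s3 \<le> (1 - t) * ?U s1 + t * ?U s2"
    proof (rule field_le_epsilon)
      fix \<epsilon>' :: real assume "\<epsilon>' > 0"
      define \<epsilon> where "\<epsilon> = \<epsilon>' / 2"
      have \<epsilon>: "\<epsilon> > 0" using \<open>\<epsilon>' > 0\<close> by (simp add: \<epsilon>_def)
      have "\<exists>\<delta>>0. \<forall>x. dist x (\<gamma> s) < \<delta> \<longrightarrow> \<bar>V x - V (\<gamma> s)\<bar> < \<epsilon>" if "s \<in> I" for s
      proof -
        have "isCont V (\<gamma> s)" using V(2) S(1) sub that by (auto simp: continuous_on_eq_continuous_at)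
        then show ?thesis using \<epsilon> by (simp add: continuous_at_eps_delta dist_real_def)
      qed
      then obtain \<delta> where \<delta>: "\<And>s. s \<in> I \<Longrightarrow> \<delta> s > 0"
        "\<And>s x. s \<in> I \<Longrightarrow> dist x (\<gamma> s) < \<delta> s \<Longrightarrow> \<bar>V x - V (\<gamma> s)\<bar> < \<epsilon>" by metis
      define r' where "r' = Min {r, \<delta> s1 / 2, \<delta> s2 / 2, \<delta> s3 / 2}"
      have r': "r' > 0" "r' \<le> r" using r(1) \<delta>(1) sI by (auto simp: r'_def)
      have r'': "r' < \<delta> s" if "s \<in> {s1, s2, s3}" for s
      proof -
        have "r' \<le> \<delta> s / 2" unfolding r'_def using that by (intro Min_le) auto
        then show ?thesis using \<delta>(1)[of s] sI that by auto
      qed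
      obtain \<phi> where \<phi>: "test_function (cball x0 r') \<phi>" "\<And>x. 0 \<le> \<phi> x"
        "\<And>x. x \<notin> cball x0 r' \<Longrightarrow> \<phi> x = 0" "(LINT x|lborel. \<phi> x) > 0"
        using ex_localized_bump[OF r'(1), of x0] by blast
      define N where "N = (LINT x|lborel. \<phi> x)"
      define \<Phi> where "\<Phi> h = (LINT x|lebesgue_on S. V x * \<phi> (x - h *\<^sub>R e))" for h
      define \<Phi>' where "\<Phi>' h = - (LINT x|lebesgue_on S. V x * dir_deriv e \<phi> (x - h *\<^sub>R e))" for h
      define \<Phi>'' where "\<Phi>'' h = (LINT x|lebesgue_on S. V x * dir_deriv e (dir_deriv e \<phi>) (x - h *\<^sub>R e))" for h
      have out: "\<phi> (x - h *\<^sub>R e) = 0" if "x \<notin> cball (\<gamma> h) r'" for x h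
      proof (rule \<phi>(3))
        have "dist x0 (x - h *\<^sub>R e) = dist (\<gamma> h) x" by (simp add: \<gamma>_def dist_norm algebra_simps)
        then show "x - h *\<^sub>R e \<notin> cball x0 r'" using that by simp
      qed
      have inS: "cball (\<gamma> h) r' \<subseteq> S" if "h \<in> I" for h
        using r(2) r'(2) that by (meson UN_subset_iff image_eqI order_trans subset_cball)
      have N: "(LINT x|lebesgue_on S. \<phi> (x - h *\<^sub>R e)) = N" if "h \<in> I" for h
        unfolding N_def
      proof (rule integral_shifted_test_function[OF \<phi>(1)])
        show "S \<in> sets lebesgue" using lm by (rule fmeasurableD)
        show "\<phi> (x - h *\<^sub>R e) = 0" if "x \<notin> S" for x
          using out[of x h] inS[OF \<open>h \<in> I\<close>] that by blast
      qed
      have tf: "test_function S (\<lambda>x. \<phi> (x - h *\<^sub>R e))" if "h \<in> I" for h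
      proof (rule test_function_translate[OF \<phi>(1)])
        have "(\<lambda>x. x + h *\<^sub>R e) ` cball x0 r' \<subseteq> cball (\<gamma> h) r'"
          by (auto simp: \<gamma>_def dist_norm algebra_simps)
        then show "(\<lambda>x. x + h *\<^sub>R e) ` cball x0 r' \<subseteq> S" using inS[OF that] by blast
      qed
      have conv: "convex_on I (\<lambda>h. C * N * h\<^sup>2 + \<sigma> * \<Phi> h)"
      proof (rule f''_ge0_imp_convex)
        show "convex I" by (simp add: I_def)
        show "((\<lambda>h. C * N * h\<^sup>2 + \<sigma> * \<Phi> h) has_real_derivative (C * N * (2 * h) + \<sigma> * \<Phi>' h)) (at h)" for h
          unfolding \<Phi>_def \<Phi>'_def
          by (auto intro!: derivative_eq_intros has_real_derivative_integral_shifted_test_function[OF iV \<phi>(1)])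
        have "(\<Phi>' has_real_derivative \<Phi>'' h) (at h)" for h
          using DERIV_minus[OF has_real_derivative_integral_shifted_test_function[OF iV test_function_dir_deriv[OF \<phi>(1)]]]
          unfolding \<Phi>'_def[abs_def] \<Phi>''_def by simp
        then show "((\<lambda>h. C * N * (2 * h) + \<sigma> * \<Phi>' h) has_real_derivative (C * N * 2 + \<sigma> * \<Phi>'' h)) (at h)" for h
          by (auto intro!: derivative_eq_intros)
        show "0 \<le> C * N * 2 + \<sigma> * \<Phi>'' h" if h: "h \<in> I" for h
        proof -
          have "\<bar>\<Phi>'' h\<bar> \<le> C * N"
            using C(2)[OF tf[OF h] \<phi>(2)] unfolding N[OF h] \<Phi>''_def dir_deriv_translate[OF \<phi>(1)]
              dir_deriv_translate[OF test_function_dir_deriv[OF \<phi>(1)]] .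
          moreover have "C * N \<ge> 0" using C(1) \<phi>(4) by (simp add: N_def)
          ultimately show ?thesis using \<sigma> by auto
        qed
      qed
      have close: "\<bar>\<sigma> * \<Phi> s - N * (\<sigma> * V (\<gamma> s))\<bar> \<le> N * \<epsilon>" if s: "s \<in> {s1, s2, s3}" for s
      proof -
        have sI': "s \<in> I" using s sI by blast
        have i1: "integrable (lebesgue_on S) (\<lambda>x. V x * \<phi> (x - s *\<^sub>R e))"
          by (rule integrable_mult_test_function[OF iV tf[OF sI']])
        have "integrable (lebesgue_on S) (\<lambda>x. 1 * \<phi> (x - s *\<^sub>R e))"
          by (rule integrable_mult_test_function[OF _ tf[OF sI']])
            (simp add: finite_measure.integrable_const finite_measure_lebesgue_on[OF lm])
        then have i2: "integrable (lebesgue_on S) (\<lambda>x. \<phi> (x - s *\<^sub>R e))" by simp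
        have "\<Phi> s - N * V (\<gamma> s) = (LINT x|lebesgue_on S. V x * \<phi> (x - s *\<^sub>R e) - V (\<gamma> s) * \<phi> (x - s *\<^sub>R e))"
          unfolding \<Phi>_def N[OF sI', symmetric] using i1 i2 by simp
        also have "\<bar>\<dots>\<bar> \<le> (LINT x|lebesgue_on S. \<epsilon> * \<phi> (x - s *\<^sub>R e))"
        proof (rule integral_abs_bound[THEN order_trans], rule integral_mono)
          fix x
          show "\<bar>V x * \<phi> (x - s *\<^sub>R e) - V (\<gamma> s) * \<phi> (x - s *\<^sub>R e)\<bar> \<le> \<epsilon> * \<phi> (x - s *\<^sub>R e)"
          proof (cases "x \<in> cball (\<gamma> s) r'")
            case True
            then have "dist x (\<gamma> s) < \<delta> s" using r''[OF s] by (simp add: dist_commute)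
            from \<delta>(2)[OF sI' this] have "\<bar>V x - V (\<gamma> s)\<bar> * \<phi> (x - s *\<^sub>R e) \<le> \<epsilon> * \<phi> (x - s *\<^sub>R e)"
              by (intro mult_right_mono \<phi>(2)) simp
            then show ?thesis using \<phi>(2) by (simp add: abs_mult flip: left_diff_distrib)
          qed (simp add: out)
        qed (use i1 i2 in simp_all)
        also have "\<dots> = N * \<epsilon>" using N[OF sI'] by simp
        finally have "\<bar>\<Phi> s - N * V (\<gamma> s)\<bar> \<le> N * \<epsilon>" .
        then show ?thesis using \<sigma> by (auto simp: abs_minus_commute)
      qed
      have a: "C * N * s\<^sup>2 + \<sigma> * \<Phi> s \<le> C * N * s\<^sup>2 + N * (\<sigma> * V (\<gamma> s)) + N * \<epsilon>"
        if "s \<in> {s1, s2, s3}" for s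
        using close[OF that] by linarith
      have "C * N * s3\<^sup>2 + \<sigma> * \<Phi> s3 \<le> (1 - t) * (C * N * s1\<^sup>2 + \<sigma> * \<Phi> s1) + t * (C * N * s2\<^sup>2 + \<sigma> * \<Phi> s2)"
        unfolding s3_def using convex_onD[OF conv, of t s1 s2] t sI by simp
      also have "\<dots> \<le> (1 - t) * (C * N * s1\<^sup>2 + N * (\<sigma> * V (\<gamma> s1)) + N * \<epsilon>) + t * (C * N * s2\<^sup>2 + N * (\<sigma> * V (\<gamma> s2)) + N * \<epsilon>)"
        by (rule add_mono[OF mult_left_mono[OF a] mult_left_mono[OF a]]) (use t in auto)
      also have "\<dots> = N * ((1 - t) * ?U s1 + t * ?U s2) + N * \<epsilon>"
        by (simp add: algebra_simps)
      also have "\<dots> = N * ((1 - t) * ?U s1 + t * ?U s2 + \<epsilon>') - N * \<epsilon>"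
        by (simp add: \<epsilon>_def algebra_simps)
      finally have upper: "C * N * s3\<^sup>2 + \<sigma> * \<Phi> s3 \<le> N * ((1 - t) * ?U s1 + t * ?U s2 + \<epsilon>') - N * \<epsilon>" .
      have "N * ?U s3 = C * N * s3\<^sup>2 + N * (\<sigma> * V (\<gamma> s3))" by (simp add: algebra_simps)
      moreover have "N * (\<sigma> * V (\<gamma> s3)) \<le> \<sigma> * \<Phi> s3 + N * \<epsilon>" using close[of s3] by (simp add: abs_le_iff)
      ultimately have "N * ?U s3 \<le> N * ((1 - t) * ?U s1 + t * ?U s2 + \<epsilon>')" using upper by linarith
      then show "?U s3 \<le> (1 - t) * ?U s1 + t * ?U s2 + \<epsilon>'"
        using \<phi>(4) unfolding N_def by (simp only: mult_le_cancel_left_pos)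
    qed
    then show "C * ((1 - t) *\<^sub>R s1 + t *\<^sub>R s2)\<^sup>2 + \<sigma> * V (x0 + ((1 - t) *\<^sub>R s1 + t *\<^sub>R s2) *\<^sub>R e)
      \<le> (1 - t) * (C * s1\<^sup>2 + \<sigma> * V (x0 + s1 *\<^sub>R e)) + t * (C * s2\<^sup>2 + \<sigma> * V (x0 + s2 *\<^sub>R e))"
      unfolding s3_def \<gamma>_def .
  qed
  then show thesis using that C(1) by blast
qed

section \<open>Continuity of the drift\<close>

text \<open>
For a continuous function the set where an essential bound fails is open and null, hence empty.
This makes the bound usable under measures that are singular to Lebesgue measure.
\<close>
lemma Lp_on_infinity_pointwise_bound:
  assumes "Lp_on \<infinity> S u" "open S" "continuous_on S u"
  obtains C where "\<And>x. x \<in> S \<Longrightarrow> \<bar>u x\<bar> \<le> C"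
proof -
  obtain C where C: "AE x in lebesgue_on S. \<bar>u x\<bar> \<le> C"
    using Lp_on_infinity_bound[OF assms(1)] by blast
  define T where "T = S \<inter> (\<lambda>x. \<bar>u x\<bar>) -` {C<..}"
  have T: "open T" unfolding T_def
    by (intro continuous_open_preimage assms continuous_intros open_greaterThan)
  have "AE x in lebesgue. x \<in> S \<longrightarrow> \<bar>u x\<bar> \<le> C"
    using C assms(2) by (subst (asm) AE_restrict_space_iff) auto
  then have "AE x in lebesgue. x \<notin> T" by eventually_elim (auto simp: T_def)
  then have "T \<in> null_sets lebesgue" using T by (subst AE_iff_null_sets) auto
  then have "T = {}" using T open_not_negligible negligible_iff_null_sets by blast
  then show thesis by (intro that[of C]) (force simp: T_def)
qed

lemma convex_on_transform:
  assumes f: "convex_on J f" and eq: "\<And>s. s \<in> J \<Longrightarrow> g s = f s"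
  shows "convex_on J g"
proof (rule convex_onI)
  show J: "convex J" using f by (rule convex_on_imp_convex)
  fix t x y assume t: "0 < (t :: real)" "t < 1" and xy: "x \<in> J" "y \<in> J"
  then have "(1 - t) *\<^sub>R x + t *\<^sub>R y \<in> J" using convexD[OF J xy, of "1 - t" t] by simp
  then show "g ((1 - t) *\<^sub>R x + t *\<^sub>R y) \<le> (1 - t) * g x + t * g y"
    using convex_onD[OF f, of t x y] t xy by (simp add: eq)
qed

lemma convex_on_integral:
  fixes f :: "real \<Rightarrow> 'b \<Rightarrow> real"
  assumes "convex J" "\<And>y. y \<in> space M \<Longrightarrow> convex_on J (\<lambda>s. f s y)"
    and int: "\<And>s. s \<in> J \<Longrightarrow> integrable M (f s)"
  shows "convex_on J (\<lambda>s. LINT y|M. f s y)"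
proof (rule convex_onI[OF _ assms(1)])
  fix t s1 s2 :: real assume t: "0 < t" "t < 1" and s: "s1 \<in> J" "s2 \<in> J"
  have s3: "(1 - t) *\<^sub>R s1 + t *\<^sub>R s2 \<in> J" using convexD[OF assms(1) s, of "1 - t" t] t by simp
  have "(LINT y|M. f ((1 - t) *\<^sub>R s1 + t *\<^sub>R s2) y) \<le> (LINT y|M. (1 - t) * f s1 y + t * f s2 y)"
    using int s s3 t by (intro integral_mono convex_onD[OF assms(2)]) auto
  also have "\<dots> = (1 - t) * (LINT y|M. f s1 y) + t * (LINT y|M. f s2 y)"
    using int s by simp
  finally show "(LINT y|M. f ((1 - t) *\<^sub>R s1 + t *\<^sub>R s2) y) \<le> (1 - t) * (LINT y|M. f s1 y) + t * (LINT y|M. f s2 y)" .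
qed

text \<open>
Lines in direction \<open>(e, 0)\<close> of the product space through \<open>(0, y)\<close> freeze the second variable, and
the semiconvexity constant for this direction is the same for all \<open>y\<close>. Integrating over \<open>y\<close> thus
keeps the integrated kernel semiconvex and semiconcave along the ray, with this constant multiplied
by the mass of the ball.
\<close>
lemma potential_C1_along_ray:
  fixes V :: "real^'n \<Rightarrow> real" and K :: "real^'n \<Rightarrow> real^'n \<Rightarrow> real"
  assumes V: "sobolev 2 \<infinity> (ball 0 R) V" "continuous_on (ball 0 R) V"
    and K: "sobolev 2 \<infinity> (ball 0 R \<times> ball 0 R) (\<lambda>(x, y). K x y)"
      "continuous_on (ball 0 R \<times> ball 0 R) (\<lambda>(x, y). K x y)"
    and \<mu>: "sets \<mu> = sets borel" "finite_measure \<mu>" and e: "norm e = 1"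
  obtains U' where "\<And>s. s \<in> {0<..<R} \<Longrightarrow>
      ((\<lambda>s. V (s *\<^sub>R e) + (LINT y:ball 0 R|\<mu>. K (s *\<^sub>R e) y)) has_real_derivative U' s) (at s)"
    "continuous_on {0<..<R} U'"
proof -
  interpret finite_measure \<mu> by fact
  let ?B = "ball (0 :: real^'n) R" and ?J = "{0<..<R}"
  have J: "open ?J" "convex ?J" by auto
  have seB: "s *\<^sub>R e \<in> ?B" if "s \<in> ?J" for s using that e by simp
  define W where "W s = (LINT y:?B|\<mu>. K (s *\<^sub>R e) y)" for s
  obtain CV where CV: "CV \<ge> 0" "\<And>\<sigma> x0. \<sigma> \<in> {1, - 1} \<Longrightarrow>
      convex_on {s. x0 + s *\<^sub>R e \<in> ?B} (\<lambda>s. CV * s\<^sup>2 + \<sigma> * V (x0 + s *\<^sub>R e))"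
    by (rule sobolev_2_infinity_semiconvex[of ?B V e]) (use V in auto)
  obtain CK where CK: "CK \<ge> 0" "\<And>\<sigma> x0. \<sigma> \<in> {1, - 1} \<Longrightarrow>
      convex_on {s. x0 + s *\<^sub>R (e, 0) \<in> ?B \<times> ?B} (\<lambda>s. CK * s\<^sup>2 + \<sigma> * (case x0 + s *\<^sub>R (e, 0) of (x, y) \<Rightarrow> K x y))"
    by (rule sobolev_2_infinity_semiconvex[of "?B \<times> ?B" "\<lambda>(x, y). K x y" "(e, 0)"])
      (use K in \<open>auto intro!: open_Times convex_Times bounded_Times\<close>)
  have "Lp_on \<infinity> (?B \<times> ?B) (\<lambda>(x, y). K x y)" using K(1) unfolding numeral_2_eq_2 by simp
  then obtain k where "\<And>z. z \<in> ?B \<times> ?B \<Longrightarrow> \<bar>case z of (x, y) \<Rightarrow> K x y\<bar> \<le> k"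
    using Lp_on_infinity_pointwise_bound[OF _ open_Times[OF open_ball open_ball] K(2)] by blast
  then have k: "\<bar>K x y\<bar> \<le> k" if "x \<in> ?B" "y \<in> ?B" for x y
    using that by fastforce
  have Bm: "?B \<in> sets \<mu>" by (simp add: \<mu>(1))
  then have ind: "integrable \<mu> (indicat_real ?B)"
    by (intro integrable_real_indicator) (simp_all add: less_top[symmetric])
  have int: "integrable \<mu> (\<lambda>y. indicator ?B y *\<^sub>R K x y)" if x: "x \<in> ?B" for x
  proof (rule integrable_const_bound[of _ "\<bar>k\<bar>"])
    have "continuous_on ?B (\<lambda>y. case (x, y) of (x, y) \<Rightarrow> K x y)"
      by (rule continuous_on_compose2[OF K(2)]) (use x in \<open>auto intro!: continuous_intros\<close>)
    then have "continuous_on ?B (K x)" by simp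
    then have "(\<lambda>y. indicator ?B y *\<^sub>R K x y) \<in> borel_measurable borel"
      by (intro borel_measurable_continuous_on_indicator) auto
    then show "(\<lambda>y. indicator ?B y *\<^sub>R K x y) \<in> borel_measurable \<mu>"
      using measurable_cong_sets[OF \<mu>(1) refl] by blast
    show "AE y in \<mu>. norm (indicator ?B y *\<^sub>R K x y) \<le> \<bar>k\<bar>"
      using k[OF x] by (intro AE_I2) (force simp: indicator_def intro: order_trans)
  qed
  have W: "convex_on ?J (\<lambda>s. (CK * measure \<mu> ?B) * s\<^sup>2 + \<sigma> * W s)" if \<sigma>: "\<sigma> \<in> {1, - 1}" for \<sigma>
  proof -
    have "convex_on ?J (\<lambda>s. LINT y|\<mu>. (CK * s\<^sup>2) * indicator ?B y + \<sigma> * (indicator ?B y *\<^sub>R K (s *\<^sub>R e) y))"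
    proof (rule convex_on_integral[OF J(2)])
      fix y
      show "convex_on ?J (\<lambda>s. (CK * s\<^sup>2) * indicator ?B y + \<sigma> * (indicator ?B y *\<^sub>R K (s *\<^sub>R e) y))"
      proof (cases "y \<in> ?B")
        case True
        have "convex_on ?J (\<lambda>s. CK * s\<^sup>2 + \<sigma> * (case (0, y) + s *\<^sub>R (e, 0) of (x, y) \<Rightarrow> K x y))"
          by (rule convex_on_subset[OF CK(2)[OF \<sigma>]]) (use True e in auto)
        then show ?thesis using True by simp
      next
        case False
        then show ?thesis using J(2) by (simp add: convex_on_const)
      qed
    next
      fix s assume "s \<in> ?J"
      then show "integrable \<mu> (\<lambda>y. (CK * s\<^sup>2) * indicator ?B y + \<sigma> * (indicator ?B y *\<^sub>R K (s *\<^sub>R e) y))"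
        using seB by (intro Bochner_Integration.integrable_add integrable_mult_right ind int)
    qed
    moreover have "(LINT y|\<mu>. (CK * s\<^sup>2) * indicator ?B y + \<sigma> * (indicator ?B y *\<^sub>R K (s *\<^sub>R e) y))
        = (CK * measure \<mu> ?B) * s\<^sup>2 + \<sigma> * W s" if "s \<in> ?J" for s
    proof -
      have "integrable \<mu> (\<lambda>y. (CK * s\<^sup>2) * indicator ?B y)" by (intro integrable_mult_right ind)
      moreover have "integrable \<mu> (\<lambda>y. \<sigma> * (indicator ?B y *\<^sub>R K (s *\<^sub>R e) y))"
        using int[OF seB[OF that]] by (intro integrable_mult_right)
      ultimately show ?thesis using Bm sets.sets_into_space[OF Bm]
        by (subst Bochner_Integration.integral_add) (auto simp: W_def set_lebesgue_integral_def Int_absorb2)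
    qed
    ultimately show ?thesis by (rule convex_on_transform[OF _ sym])
  qed
  define C where "C = CV + CK * measure \<mu> ?B"
  define U where "U s = V (s *\<^sub>R e) + W s" for s
  have U: "convex_on ?J (\<lambda>s. C * s\<^sup>2 + \<sigma> * U s)" if \<sigma>: "\<sigma> \<in> {1, - 1}" for \<sigma>
  proof -
    have "convex_on ?J (\<lambda>s. CV * s\<^sup>2 + \<sigma> * V (0 + s *\<^sub>R e))"
      by (rule convex_on_subset[OF CV(2)[OF \<sigma>]]) (use e in auto)
    from convex_on_add[OF this W[OF \<sigma>]] show ?thesis
      by (simp add: C_def U_def algebra_simps)
  qed
  have up: "convex_on ?J (\<lambda>s. C * s\<^sup>2 + U s)" and lo: "convex_on ?J (\<lambda>s. C * s\<^sup>2 - U s)"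
    using U[of 1] U[of "- 1"] by simp_all
  obtain f' where f': "\<And>s. s \<in> ?J \<Longrightarrow> ((\<lambda>s. C * s\<^sup>2 + U s) has_real_derivative f' s) (at s)" "continuous_on ?J f'"
    using C1_if_semiconvex_semiconcave[OF J(1) up lo, of "2 * C"] by auto
  show thesis
  proof (rule that)
    show "continuous_on ?J (\<lambda>s. f' s - 2 * C * s)" by (intro continuous_intros f'(2))
    fix s assume s: "s \<in> ?J"
    have "((\<lambda>s. (C * s\<^sup>2 + U s) - C * s\<^sup>2) has_real_derivative f' s - 2 * C * s) (at s)"
      by (rule derivative_eq_intros f'(1)[OF s] refl | simp)+
    then show "((\<lambda>s. V (s *\<^sub>R e) + (LINT y:?B|\<mu>. K (s *\<^sub>R e) y)) has_real_derivative f' s - 2 * C * s) (at s)"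
      by (simp add: U_def W_def)
  qed
qed

lemma ball_vol_eq:
  assumes "0 \<le> r"
  shows "ball_vol TYPE('n::finite) r = ball_vol TYPE('n) 1 * r ^ CARD('n)" "ball_vol TYPE('n) 1 > 0"
  using assms content_ball[of r "0 :: real^'n"] content_ball[of 1 "0 :: real^'n"]
  by (simp_all add: ball_vol_def)

text \<open>
In the volume variable the potential is composed with \<open>vradius\<close>, which is smooth away from \<open>v = 0\<close>;
the chain rule expresses the drift through the continuous derivative along the ray.
\<close>
lemma drift_continuous:
  fixes V :: "real^'n \<Rightarrow> real" and K :: "real^'n \<Rightarrow> real^'n \<Rightarrow> real"
  assumes R: "0 < R" and V: "sobolev 2 \<infinity> (ball 0 R) V" "continuous_on (ball 0 R) V"
    and K: "sobolev 2 \<infinity> (ball 0 R \<times> ball 0 R) (\<lambda>(x, y). K x y)"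
      "continuous_on (ball 0 R \<times> ball 0 R) (\<lambda>(x, y). K x y)"
    and \<mu>: "sets \<mu> = sets borel" "finite_measure \<mu>"
  shows "continuous_on {0<..<ball_vol TYPE('n) R} (drift R V K \<mu>)"
proof -
  let ?I = "{0<..<ball_vol TYPE('n) R}"
  define e :: "real^'n" where "e = (SOME e. norm e = 1)"
  have "norm (axis undefined 1 :: real^'n) = 1" by simp
  then have e: "norm e = 1" unfolding e_def by (rule someI)
  define \<omega> where "\<omega> = ball_vol TYPE('n) 1"
  have \<omega>: "\<omega> > 0" "ball_vol TYPE('n) R = \<omega> * R ^ CARD('n)"
    using ball_vol_eq[of R, where 'n = 'n] R by (simp_all add: \<omega>_def)
  let ?r = "vradius TYPE('n)"
  have r: "?r v \<in> {0<..<R}" "v / \<omega> > 0" if v: "v \<in> ?I" for v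
  proof -
    show pos: "v / \<omega> > 0" using v \<omega> by simp
    have "v / \<omega> < R ^ CARD('n)" using v \<omega> by (simp add: divide_less_eq mult.commute)
    then have "root CARD('n) (v / \<omega>) < root CARD('n) (R ^ CARD('n))" by (simp add: real_root_less_mono)
    then show "?r v \<in> {0<..<R}"
      using R pos by (simp add: vradius_def \<omega>_def[symmetric] real_root_power_cancel)
  qed
  obtain U' where U': "\<And>s. s \<in> {0<..<R} \<Longrightarrow>
      ((\<lambda>s. V (s *\<^sub>R e) + (LINT y:ball 0 R|\<mu>. K (s *\<^sub>R e) y)) has_real_derivative U' s) (at s)"
    "continuous_on {0<..<R} U'"
    using potential_C1_along_ray[OF V K \<mu> e] by blast
  define r' where "r' v = inverse (real CARD('n) * ?r v ^ (CARD('n) - Suc 0)) * (1 / \<omega>)" for v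
  have dr: "(?r has_real_derivative r' v) (at v)" if v: "v \<in> ?I" for v
  proof -
    have "((\<lambda>v. v / \<omega>) has_real_derivative 1 / \<omega>) (at v)"
      using \<omega>(1) by (auto intro!: derivative_eq_intros)
    from DERIV_chain2[OF DERIV_real_root[OF _ r(2)[OF v]] this, of "CARD('n)"]
    show ?thesis by (simp add: vradius_def[abs_def] \<omega>_def[symmetric] r'_def)
  qed
  have eq: "drift R V K \<mu> v = U' (?r v) * r' v" if v: "v \<in> ?I" for v
    unfolding drift_def radial_profile_def e_def[symmetric]
    by (rule DERIV_imp_deriv[OF DERIV_chain2[OF U'(1)[OF r(1)[OF v]] dr[OF v]]])
  have rc: "continuous_on ?I ?r"
    using dr by (intro continuous_at_imp_continuous_on ballI DERIV_isCont) blast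
  have "continuous_on ?I (\<lambda>v. U' (?r v) * r' v)"
    unfolding r'_def
    by (intro continuous_intros continuous_on_compose2[OF U'(2)] rc) (use r(1) \<omega>(1) in force)+
  then show ?thesis by (subst continuous_on_cong[OF refl eq])
qed

section \<open>Regularity of the limit profile\<close>

theorem proposition2p9:
  fixes m R :: real
    and \<rho>0 V :: "real^'n \<Rightarrow> real"
    and K :: "real^'n \<Rightarrow> real^'n \<Rightarrow> real"
    and \<rho> :: "real \<Rightarrow> real^'n \<Rightarrow> real"
    and tn :: "nat \<Rightarrow> real"
    and \<mu> :: "(real^'n) measure"
    and M :: "real \<Rightarrow> real"
  assumes m: "0 < m" "m < 1" and R: "0 < R"
    and \<rho>0: "Lp_on \<infinity> (ball 0 R) \<rho>0"
      "AE x in lebesgue_on (ball 0 R). 0 \<le> \<rho>0 x"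
      "\<forall>Q\<in>rotations. AE x in lebesgue_on (ball 0 R). \<rho>0 (Q *v x) = \<rho>0 x"
    \<comment> \<open>\<open>V\<close> and \<open>K\<close> are the continuous (hence \<open>C\<^sup>1\<close>) representatives of their classes\<close>
    and V: "sobolev 2 \<infinity> (ball 0 R) V" "continuous_on (ball 0 R) V"
      "\<forall>x\<in>ball 0 R. 0 \<le> V x" "neumann R V"
      "\<forall>Q\<in>rotations. \<forall>x\<in>ball 0 R. V (Q *v x) = V x"
    and K: "sobolev 2 \<infinity> (ball 0 R \<times> ball 0 R) (\<lambda>(x, y). K x y)"
      "continuous_on (ball 0 R \<times> ball 0 R) (\<lambda>(x, y). K x y)"
      "\<forall>x\<in>ball 0 R. \<forall>y\<in>ball 0 R. K x y = K y x \<and> 0 \<le> K x y"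
      "\<forall>y\<in>ball 0 R. neumann R (\<lambda>x. K x y)"
      "\<forall>Q\<in>rotations. \<forall>x\<in>ball 0 R. \<forall>y\<in>ball 0 R. K (Q *v x) (Q *v y) = K x y"
    and \<rho>: "strong_solution m R V K \<rho>0 \<rho>"
    and tn: "filterlim tn at_top sequentially"
    and limit: "long_time_limit R \<rho> tn \<mu> M"
    and viscosity: "viscosity_solution {0<..<ball_vol TYPE('n) R}
      (\<lambda>v p X. (kappa TYPE('n) v)\<^sup>2 * (X + 1 / m * p powr (2 - m) * drift R V K \<mu> v)) M"
    and drift: "\<forall>v\<in>{0<..<ball_vol TYPE('n) R}. 0 \<le> drift R V K \<mu> v"
  shows "C_k_on 2 {0<..<ball_vol TYPE('n) R} M"
proof -
  let ?I = "{0<..<ball_vol TYPE('n) R}" and ?E = "drift R V K \<mu>"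
  define H where "H p = 1 / m * p powr (2 - m)" for p
  have mu: "sets \<mu> = sets borel" "finite_measure \<mu>"
    using limit unfolding long_time_limit_def radial_measure_def Let_def by auto
  have "mono_on {0..ball_vol TYPE('n) R} M"
    using limit unfolding long_time_limit_def Let_def by auto
  then have mono: "mono_on ?I M" by (rule mono_on_subset) auto
  have cont: "continuous_on ?I M" using viscosity unfolding viscosity_solution_def by blast
  have H: "continuous_on {0..} H" "0 \<le> H p" for p
    using m unfolding H_def by (auto intro!: continuous_intros continuous_on_powr')
  \<comment> \<open>The weight is positive away from \<open>v = 0\<close>, so the equation can be divided by it.\<close>
  have kappa: "(kappa TYPE('n) v)\<^sup>2 > 0" if "v \<in> ?I" for v
    using that ball_vol_eq(2)[of R, where 'n = 'n] R unfolding kappa_def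
    by (intro zero_less_power mult_pos_pos) auto
  show ?thesis
  proof (rule degenerate_viscosity_solution_C2[OF _ _ cont mono drift_continuous[OF R V(1,2) K(1,2) mu] _ H])
    fix a p q assume a: "a \<in> ?I"
    note touching = viscosity_solution_touching_parabola[OF viscosity a open_greaterThanLessThan, of p q]
    show "0 \<le> 2 * q + H p * ?E a" if "\<forall>\<^sub>F v in nhds a. M v \<le> M a + p * (v - a) + q * (v - a)\<^sup>2"
      using touching(1)[OF that] kappa[OF a] by (simp add: H_def zero_le_mult_iff)
    show "2 * q + H p * ?E a \<le> 0" if "\<forall>\<^sub>F v in nhds a. M v \<ge> M a + p * (v - a) + q * (v - a)\<^sup>2"
      using touching(2)[OF that] kappa[OF a] by (simp add: H_def mult_le_0_iff)
  qed (use drift in auto)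
qed

end
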